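(* Let $d,m,n\in\mathbb{N}$, let $a_1,\ldots,a_n\in\mathbb{C}^{d\times m}$ be deterministic matrices, let $b\in\mathbb{C}^{d\times d}_{\rm s.a.}$, and let $x=\sum_{i=1}^n a_i\otimes s_i$, where $s_1,\ldots,s_n$ is a free semicircular family. Then $$\lambda_{\rm max}(xx^*+b\otimes\mathbf{1})=\inf_{\substack{z>0\\ \sum_j a_j^*za_j<\mathbf{1}}}\lambda_{\rm max}\Bigg(b+z^{-1}+\sum_{i=1}^n a_i\Bigg(\mathbf{1}-\sum_{j=1}^n a_j^*za_j\Bigg)^{-1}a_i^*\Bigg)$$ and $$\lambda_{\rm min}(xx^*+b\otimes\mathbf{1})=\sup_{z<0}\,\lambda_{\rm min}\Bigg(b+z^{-1}+\sum_{i=1}^n a_i\Bigg(\mathbf{1}-\sum_{j=1}^n a_j^*za_j\Bigg)^{-1}a_i^*\Bigg),$$ where $z$ ranges over $\mathbb{C}^{d\times d}_{\rm s.a.}$. Moreover, in the first formula the infimum can be restricted to those $z$ (satisfying the same constraints) for which the matrix inside $\lambda_{\rm max}(\cdots)$ on the right-hand side is a multiple of the identity, without changing its value; and in the second formula the supremum can be restricted to those $z<0$ for which the matrix inside $\lambda_{\rm min}(\cdots)$ on the right-hand side is a multiple of the identity, without changing its value.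
   Context: $\mathbb{C}^{d\times d}_{\rm s.a.}$ is the set of self-adjoint $d\times d$ complex matrices; $\mathbf{1}$ is the identity (matrix or operator); $A>B$ for self-adjoint $A,B$ means $A-B$ is positive definite, and $z<0$ means $-z>0$. For self-adjoint $y$ with spectrum $\mathrm{sp}(y)$, $\lambda_{\rm max}(y)=\sup\mathrm{sp}(y)$ and $\lambda_{\rm min}(y)=\inf\mathrm{sp}(y)$. A free semicircular family $s_1,\ldots,s_n$ is a family of freely independent self-adjoint elements of a $C^*$-probability space $(\mathcal{S},\tau)$ with faithful trace $\tau$, each having the standard semicircular distribution (density $\frac{1}{2\pi}\sqrt{4-t^2}$ on $[-2,2]$). The element $x\in\mathbb{C}^{d\times m}\otimes\mathcal{S}$ is regarded as a $d\times m$ matrix with entries in $\mathcal{S}$, so that $xx^*\in\mathbb{C}^{d\times d}\otimes\mathcal{S}$. *)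

theory Defs
  imports "HOL-Analysis.Analysis" "HOL-Probability.Probability_Measure"
begin

class cstar_algebra = real_normed_algebra_1 + banach +
  fixes scaleC :: "complex \<Rightarrow> 'a \<Rightarrow> 'a" (infixr "*\<^sub>C" 75)
    and star :: "'a \<Rightarrow> 'a"
  assumes scaleC_add_right: "c *\<^sub>C (x + y) = c *\<^sub>C x + c *\<^sub>C y"
    and scaleC_add_left: "(c + c') *\<^sub>C x = c *\<^sub>C x + c' *\<^sub>C x"
    and scaleC_scaleC: "c *\<^sub>C c' *\<^sub>C x = (c * c') *\<^sub>C x"
    and scaleC_one: "1 *\<^sub>C x = x"
    and scaleR_scaleC: "r *\<^sub>R x = complex_of_real r *\<^sub>C x"
    and mult_scaleC_left: "(c *\<^sub>C x) * y = c *\<^sub>C (x * y)"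
    and mult_scaleC_right: "x * (c *\<^sub>C y) = c *\<^sub>C (x * y)"
    and norm_scaleC: "norm (c *\<^sub>C x) = cmod c * norm x"
    and star_star: "star (star x) = x"
    and star_add: "star (x + y) = star x + star y"
    and star_mult: "star (x * y) = star y * star x"
    and star_scaleC: "star (c *\<^sub>C x) = cnj c *\<^sub>C star x"
    and norm_star_mult_self: "norm (star x * x) = (norm x)\<^sup>2"

text \<open>With this instance the notions below for matrices over a C*-algebra also apply to
  complex matrices.\<close>

instantiation complex :: cstar_algebra
begin

definition scaleC_complex :: "complex \<Rightarrow> complex \<Rightarrow> complex" where
  "scaleC_complex c x = c * x"

definition star_complex :: "complex \<Rightarrow> complex" where
  "star_complex x = cnj x"

instance
  by standard
    (auto simp: scaleC_complex_def star_complex_def algebra_simps scaleR_conv_of_real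
      norm_mult power2_eq_square)

end


definition faithful_tracial_state :: "('a::cstar_algebra \<Rightarrow> complex) \<Rightarrow> bool" where
  "faithful_tracial_state \<tau> \<longleftrightarrow>
     (\<forall>x y. \<tau> (x + y) = \<tau> x + \<tau> y) \<and>
     (\<forall>c x. \<tau> (c *\<^sub>C x) = c * \<tau> x) \<and>
     \<tau> 1 = 1 \<and>
     (\<forall>x. \<tau> (star x * x) \<in> \<real>\<^sub>\<ge>\<^sub>0) \<and>
     (\<forall>x. \<tau> (star x * x) = 0 \<longrightarrow> x = 0) \<and>
     (\<forall>x y. \<tau> (x * y) = \<tau> (y * x))"

definition unital_star_subalgebra :: "'a::cstar_algebra set \<Rightarrow> bool" where
  "unital_star_subalgebra B \<longleftrightarrow>
     1 \<in> B \<and>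
     (\<forall>x\<in>B. \<forall>y\<in>B. x + y \<in> B) \<and>
     (\<forall>x\<in>B. \<forall>y\<in>B. x * y \<in> B) \<and>
     (\<forall>c. \<forall>x\<in>B. c *\<^sub>C x \<in> B) \<and>
     (\<forall>x\<in>B. star x \<in> B)"

definition free_subalgebras ::
    "('a::cstar_algebra \<Rightarrow> complex) \<Rightarrow> ('i \<Rightarrow> 'a set) \<Rightarrow> bool" where
  "free_subalgebras \<tau> B \<longleftrightarrow>
     (\<forall>js ys. js \<noteq> [] \<and> distinct_adj js \<and> length ys = length js \<and>
        (\<forall>k<length js. ys ! k \<in> B (js ! k) \<and> \<tau> (ys ! k) = 0)
        \<longrightarrow> \<tau> (prod_list ys) = 0)"

definition freely_independent ::
    "('a::cstar_algebra \<Rightarrow> complex) \<Rightarrow> ('i \<Rightarrow> 'a) \<Rightarrow> bool" where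
  "freely_independent \<tau> s \<longleftrightarrow>
     free_subalgebras \<tau> (\<lambda>i. unital_star_subalgebra hull {s i})"

text \<open>The distribution of a self-adjoint element is the compactly supported probability
  measure on the real line with the same moments.\<close>

definition has_distribution ::
    "('a::cstar_algebra \<Rightarrow> complex) \<Rightarrow> 'a \<Rightarrow> real measure \<Rightarrow> bool" where
  "has_distribution \<tau> y \<mu> \<longleftrightarrow>
     star y = y \<and> prob_space \<mu> \<and> sets \<mu> = sets borel \<and>
     (\<exists>R. AE t in \<mu>. \<bar>t\<bar> \<le> R) \<and>
     (\<forall>k::nat. \<tau> (y ^ k) = complex_of_real (LINT t|\<mu>. t ^ k))"

definition semicircle_distribution :: "real measure" where
  "semicircle_distribution =
     density lborel (\<lambda>t. ennreal (indicator {-2..2} t * (sqrt (4 - t\<^sup>2) / (2 * pi))))"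

definition free_semicircular_family ::
    "('a::cstar_algebra \<Rightarrow> complex) \<Rightarrow> ('i \<Rightarrow> 'a) \<Rightarrow> bool" where
  "free_semicircular_family \<tau> s \<longleftrightarrow>
     freely_independent \<tau> s \<and> (\<forall>i. has_distribution \<tau> (s i) semicircle_distribution)"


definition mat_star :: "'a::cstar_algebra^'m^'d \<Rightarrow> 'a^'d^'m" where
  "mat_star A = (\<chi> i j. star (A $ j $ i))"

definition mat_tensor :: "complex^'m^'d \<Rightarrow> 'a::cstar_algebra \<Rightarrow> 'a^'m^'d"
    (infixr "\<otimes>\<^sub>C" 72) where
  "A \<otimes>\<^sub>C y = (\<chi> i j. (A $ i $ j) *\<^sub>C y)"

text \<open>The spectrum in the algebra of square matrices over the C*-algebra; over the complex
  numbers, the set of eigenvalues.\<close>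

definition spectrum :: "'a::cstar_algebra^'d^'d \<Rightarrow> complex set" where
  "spectrum A = {c. \<not> invertible (mat (c *\<^sub>C 1) - A)}"

text \<open>Meaningful for self-adjoint \<open>A\<close>, whose spectrum is real.\<close>

definition lambda_max :: "'a::cstar_algebra^'d^'d \<Rightarrow> real" where
  "lambda_max A = Sup {t. complex_of_real t \<in> spectrum A}"

definition lambda_min :: "'a::cstar_algebra^'d^'d \<Rightarrow> real" where
  "lambda_min A = Inf {t. complex_of_real t \<in> spectrum A}"

definition pos_def :: "complex^'d^'d \<Rightarrow> bool" where
  "pos_def A \<longleftrightarrow>
     mat_star A = A \<and> (\<forall>v. v \<noteq> 0 \<longrightarrow> 0 < Re (\<Sum>i\<in>UNIV. cnj (v $ i) * (A *v v) $ i))"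

definition mat_less :: "complex^'d^'d \<Rightarrow> complex^'d^'d \<Rightarrow> bool" (infix "\<prec>" 50) where
  "A \<prec> B \<longleftrightarrow> mat_star A = A \<and> mat_star B = B \<and> pos_def (B - A)"


definition conj_sum ::
    "('n::finite \<Rightarrow> complex^'m^'d) \<Rightarrow> complex^'d^'d \<Rightarrow> complex^'m^'m" where
  "conj_sum a z = (\<Sum>j\<in>UNIV. mat_star (a j) ** z ** a j)"

definition lehner_matrix ::
    "('n::finite \<Rightarrow> complex^'m^'d) \<Rightarrow> complex^'d^'d \<Rightarrow> complex^'d^'d \<Rightarrow> complex^'d^'d" where
  "lehner_matrix a b z =
     b + matrix_inv z + (\<Sum>i\<in>UNIV. a i ** matrix_inv (mat 1 - conj_sum a z) ** mat_star (a i))"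

definition scalar_matrix :: "complex^'d^'d \<Rightarrow> bool" where
  "scalar_matrix A \<longleftrightarrow> (\<exists>c. A = mat c)"

end

theory Submission
  imports Defs
begin

text \<open>The words \<open>e\<^sub>w\<close> obtained from a free semicircular family by grouping letters into Chebyshev
  polynomials are orthonormal for the trace, and \<open>s\<^sub>i e\<^sub>w = e\<^sub>i\<^sub>w + [w = i v] e\<^sub>v\<close>: their span is the free
  Fock space, on which \<open>x x\<^sup>* + b\<close> is explicit. Traciality lets form bounds pass from this span to the
  whole algebra, and for self-adjoint matrices over a C*-algebra with a faithful trace the extreme
  spectral values are the extreme values of the form.

  On the Fock space a matrix \<open>z\<close> that satisfies the constraints gives the bound
  \<open>lambda_max (lehner_matrix a b z)\<close> by Young's inequality, word by word. Conversely, for \<open>t\<close> beyond the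
  spectrum, iterating \<open>z \<mapsto> (t - b - \<Sum>i. a\<^sub>i (1 - \<Sum>j. a\<^sub>j\<^sup>* z a\<^sub>j)\<^sup>-\<^sup>1 a\<^sub>i\<^sup>*)\<^sup>-\<^sup>1\<close> from \<open>0\<close> is monotone; explicit test
  vectors, which are Schur complements in disguise, show that the matrices to be inverted stay bounded
  below by the spectral gap. The limit solves \<open>lehner_matrix a b z = t\<close>.\<close>

section \<open>Square roots in a C*-algebra\<close>

text \<open>The algebra may be larger than what the \<open>s i\<close> generate, so the words need
  not be dense in it. This is why form bounds are propagated through powers of a matrix on basis
  vectors and right multiplication, and not by approximation. No C*-norm on matrices is used either:
  positivity of a single element is read off from \<open>norm (1 - k) \<le> 1\<close>, which needs
  only square roots, and elimination carries invertibility over to matrices.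

  The operator acts on the first letter of a word. For the bound at a given \<open>z\<close>, words
  are read from the front, and one inequality per word suffices. For the converse they are split by
  the last letter, a spectator: fixing it leaves a copy of the whole Fock space, and the copies are
  coupled only at the empty word. Eliminating them is a Schur complement that reproduces the same
  problem; this self-similarity is the origin of the iteration. The delicate point is positivity of
  \<open>mat 1 - conj_sum a z\<close> in the limit, because strict inequalities do not survive
  limits; a non-strict quadratic inequality containing the gap takes its place.\<close>

lemma scaleC_zero_left [simp]: "0 *\<^sub>C (x::'a::cstar_algebra) = 0"
  using scaleR_scaleC[of 0 x] by simp

lemma scaleC_zero_right [simp]: "c *\<^sub>C (0::'a::cstar_algebra) = 0"
  using scaleC_scaleC[of c 0 "0::'a"] by simp

lemma star_zero [simp]: "star (0::'a::cstar_algebra) = 0"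
  using star_scaleC[of 0 "0::'a"] by simp

lemma star_one [simp]: "star (1::'a::cstar_algebra) = 1"
  by (metis mult.right_neutral star_mult star_star)

lemma star_minus: "star (- x) = - star (x::'a::cstar_algebra)"
  by (metis add.right_inverse add_eq_0_iff star_add star_zero)

lemma star_diff: "star (x - y) = star x - star (y::'a::cstar_algebra)"
  using star_add[of x "- y"] by (simp add: star_minus)

lemma star_scaleR: "star (r *\<^sub>R x) = r *\<^sub>R star (x::'a::cstar_algebra)"
  by (simp add: scaleR_scaleC star_scaleC)

lemma star_sum: "star (sum f I) = (\<Sum>i\<in>I. star (f i :: 'a::cstar_algebra))"
  by (induction I rule: infinite_finite_induct) (simp_all add: star_add)

lemma scaleC_sum_right: "c *\<^sub>C (sum f I) = (\<Sum>i\<in>I. c *\<^sub>C (f i :: 'a::cstar_algebra))"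
  by (induction I rule: infinite_finite_induct) (simp_all add: scaleC_add_right)

lemma scaleC_sum_left: "(sum f I) *\<^sub>C x = (\<Sum>i\<in>I. f i *\<^sub>C (x :: 'a::cstar_algebra))"
  by (induction I rule: infinite_finite_induct) (simp_all add: scaleC_add_left)

lemma scaleC_minus_left: "(- c) *\<^sub>C x = - (c *\<^sub>C (x::'a::cstar_algebra))"
  using scaleC_add_left[of "- c" c x] by (simp add: eq_neg_iff_add_eq_0)

lemma scaleC_diff_right: "c *\<^sub>C (x - y) = c *\<^sub>C x - c *\<^sub>C (y::'a::cstar_algebra)"
  using scaleC_add_right[of c "x - y" y] by simp

lemma star_power: "star (x ^ n) = star (x::'a::cstar_algebra) ^ n"
  by (induction n) (simp_all add: star_mult power_commutes)

lemma norm_star [simp]: "norm (star x) = norm (x::'a::cstar_algebra)"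
proof -
  have le: "norm y \<le> norm (star y)" for y :: 'a
  proof (cases "y = 0")
    case False
    have "norm y * norm y \<le> norm (star y) * norm y"
      using norm_star_mult_self[of y] norm_mult_ineq[of "star y" y] by (simp add: power2_eq_square)
    then show ?thesis using False by simp
  qed simp
  show ?thesis using le[of x] le[of "star x"] by (simp add: star_star)
qed

lemma bounded_linear_star: "bounded_linear (star :: 'a::cstar_algebra \<Rightarrow> 'a)"
  by (rule bounded_linear_intro[where K = 1]) (simp_all add: star_add star_scaleR)

lemma norm_square_self_adjoint: "star x = x \<Longrightarrow> norm (x * x) = (norm (x::'a::cstar_algebra))\<^sup>2"
  using norm_star_mult_self[of x] by simp

text \<open>The coefficients of \<open>sqrt (1 - p)\<close> as a power series in \<open>p\<close>. Apart from the first they are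
  nonpositive and their sum stays nonnegative, so that the series converges up to the boundary
  \<open>norm p = 1\<close>.\<close>

definition sqrt_coeff :: "nat \<Rightarrow> real" where
  "sqrt_coeff k = (- 1) ^ k * ((1/2) gchoose k)"

lemma sqrt_coeff_0 [simp]: "sqrt_coeff 0 = 1"
  by (simp add: sqrt_coeff_def)

lemma sqrt_coeff_Suc: "sqrt_coeff (Suc k) = sqrt_coeff k * (real k - 1/2) / (real k + 1)"
proof -
  have "(1/2::real) gchoose Suc k = - ((1/2) gchoose k) * (real k - 1/2) / (real k + 1)"
    using gbinomial_mult_1[of "1/2::real" k] by (simp add: field_simps)
  then show ?thesis by (simp add: sqrt_coeff_def)
qed

lemma sqrt_coeff_nonpos: "sqrt_coeff (Suc k) \<le> 0"
proof (induction k)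
  case 0 show ?case by (simp add: sqrt_coeff_Suc)
next
  case (Suc k)
  then show ?case
    unfolding sqrt_coeff_Suc[of "Suc k"] by (intro divide_nonpos_pos mult_nonpos_nonneg) auto
qed

text \<open>Dividing a power series by \<open>1 - p\<close> replaces its coefficients by their
  partial sums, and \<open>sqrt (1 - p) / (1 - p)\<close> is \<open>- 2\<close> times the derivative
  of \<open>sqrt (1 - p)\<close>.\<close>

lemma sum_sqrt_coeff: "(\<Sum>k\<le>n. sqrt_coeff k) = - 2 * (real n + 1) * sqrt_coeff (Suc n)"
proof (induction n)
  case 0
  have "sqrt_coeff (Suc 0) = - (1/2)" using sqrt_coeff_Suc[of 0] by simp
  then show ?case by simp
next
  case (Suc n)
  have "(\<Sum>k\<le>Suc n. sqrt_coeff k) = - 2 * (real n + 1) * sqrt_coeff (Suc n) + sqrt_coeff (Suc n)"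
    using Suc by simp
  also have "\<dots> = - 2 * (sqrt_coeff (Suc n) * (real (Suc n) - 1/2))"
    by (simp add: algebra_simps)
  also have "sqrt_coeff (Suc n) * (real (Suc n) - 1/2) = (real (Suc n) + 1) * sqrt_coeff (Suc (Suc n))"
    unfolding sqrt_coeff_Suc[of "Suc n"] by simp
  finally have "(\<Sum>k\<le>Suc n. sqrt_coeff k) = - 2 * ((real (Suc n) + 1) * sqrt_coeff (Suc (Suc n)))" .
  then show ?case by (simp only: mult.assoc)
qed

lemma sum_abs_sqrt_coeff: "(\<Sum>k<n. \<bar>sqrt_coeff (Suc k)\<bar>) \<le> 1"
proof -
  have "(\<Sum>k<n. \<bar>sqrt_coeff (Suc k)\<bar>) = - (\<Sum>k<n. sqrt_coeff (Suc k))"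
    by (simp add: sqrt_coeff_nonpos sum_negf)
  also have "\<dots> = 1 - (\<Sum>k\<le>n. sqrt_coeff k)"
    by (simp add: sum.atMost_shift)
  also have "\<dots> \<le> 1"
    using sqrt_coeff_nonpos[of n] by (simp add: sum_sqrt_coeff mult_nonpos_nonpos)
  finally show ?thesis .
qed

lemma summable_abs_sqrt_coeff_Suc: "summable (\<lambda>k. \<bar>sqrt_coeff (Suc k)\<bar>)"
  by (rule summableI_nonneg_bounded[where x = 1]) (use sum_abs_sqrt_coeff in auto)

lemma suminf_abs_sqrt_coeff: "(\<Sum>k. \<bar>sqrt_coeff (Suc k)\<bar>) \<le> 1"
  by (rule suminf_le_const[OF summable_abs_sqrt_coeff_Suc sum_abs_sqrt_coeff])

text \<open>The Cauchy square of the series has to be \<open>1 - p\<close>; Vandermonde turns the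
  convolution into \<open>1 gchoose n\<close>.\<close>

lemma sqrt_coeff_convolution:
  "(\<Sum>i\<le>n. sqrt_coeff i * sqrt_coeff (n - i)) = (if n = 0 then 1 else if n = 1 then - 1 else 0)"
proof -
  have "(\<Sum>i\<le>n. sqrt_coeff i * sqrt_coeff (n - i))
      = (- 1) ^ n * (\<Sum>i=0..n. ((1/2::real) gchoose i) * ((1/2) gchoose (n - i)))"
    unfolding sqrt_coeff_def sum_distrib_left atMost_atLeast0
  proof (intro sum.cong refl)
    fix i assume "i \<in> {0..n}"
    then have "(- 1 :: real) ^ i * (- 1) ^ (n - i) = (- 1) ^ n"
      by (metis atLeastAtMost_iff le_add_diff_inverse power_add)
    then show "(- 1) ^ i * ((1/2::real) gchoose i) * ((- 1) ^ (n - i) * ((1/2) gchoose (n - i)))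
        = (- 1) ^ n * (((1/2) gchoose i) * ((1/2) gchoose (n - i)))"
      by (simp add: mult_ac)
  qed
  also have "\<dots> = (- 1) ^ n * ((1::real) gchoose n)"
    using gbinomial_Vandermonde[of "1/2::real" "1/2" n] by simp
  also have "(1::real) gchoose n = of_nat (1 choose n)"
    by (simp add: binomial_gbinomial)
  also have "(- 1) ^ n * real (1 choose n) = (if n = 0 then 1 else if n = 1 then - 1 else 0)"
    by (cases n; cases "n - 1") (auto simp: binomial_eq_0)
  finally show ?thesis .
qed

text \<open>The power series inherits commutation from \<open>q\<close>. The bound on
  \<open>1 - h\<close> has the form of the hypothesis on \<open>q\<close>, so that roots can be
  taken repeatedly.\<close>

lemma self_adjoint_sqrt:
  fixes q :: "'a::cstar_algebra"
  assumes "star q = q" "norm (1 - q) \<le> 1"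
  obtains h where "star h = h" "h * h = q" "norm (1 - h) \<le> 1"
    "\<And>x. x * q = q * x \<Longrightarrow> x * h = h * x"
proof -
  define p where "p = 1 - q"
  define f where "f k = sqrt_coeff k *\<^sub>R p ^ k" for k
  define h where "h = suminf f"
  have p_pow: "norm (p ^ k) \<le> 1" for k
    by (rule order_trans[OF norm_power_ineq]) (use assms(2) in \<open>simp add: p_def power_le_one\<close>)
  have f_le: "norm (f k) \<le> \<bar>sqrt_coeff k\<bar>" for k
    using mult_left_mono[OF p_pow[of k], of "\<bar>sqrt_coeff k\<bar>"] by (simp add: f_def)
  have "summable (\<lambda>k. \<bar>sqrt_coeff k\<bar>)"
    using summable_abs_sqrt_coeff_Suc summable_Suc_iff by blast
  then have sn: "summable (\<lambda>k. norm (f k))"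
    by (rule summable_comparison_test[rotated]) (use f_le in auto)
  have sf: "summable f" by (rule summable_norm_cancel[OF sn])
  have f0: "f 0 = 1" by (simp add: f_def)
  have comm: "x * h = h * x" if "x * q = q * x" for x
  proof -
    have xp: "x * p = p * x" using that by (simp add: p_def algebra_simps)
    have xpk: "x * p ^ k = p ^ k * x" for k
    proof (induction k)
      case (Suc k)
      have "x * p ^ Suc k = p * (x * p ^ k)" using xp by (simp add: mult.assoc[symmetric])
      then show ?case using Suc by (simp add: mult.assoc)
    qed simp
    have "x * h = (\<Sum>k. x * f k)" unfolding h_def by (rule suminf_mult[OF sf, symmetric])
    also have "\<dots> = (\<Sum>k. f k * x)" by (simp add: f_def xpk)
    also have "\<dots> = h * x" unfolding h_def by (rule suminf_mult2[OF sf, symmetric])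
    finally show ?thesis .
  qed
  have "star p = p" using assms(1) by (simp add: p_def star_diff)
  then have "star (f k) = f k" for k by (simp add: f_def star_scaleR star_power)
  then have h1: "star h = h"
    unfolding h_def by (subst bounded_linear.suminf[OF bounded_linear_star sf]) simp
  have "h * h = (\<Sum>k. \<Sum>i\<le>k. f i * f (k - i))"
    unfolding h_def by (rule Cauchy_product[OF sn sn])
  also have "(\<lambda>k. \<Sum>i\<le>k. f i * f (k - i))
      = (\<lambda>k. (if k = 0 then 1 else if k = 1 then - 1 else 0) *\<^sub>R p ^ k)"
  proof
    fix k
    have "(\<Sum>i\<le>k. f i * f (k - i)) = (\<Sum>i\<le>k. (sqrt_coeff i * sqrt_coeff (k - i)) *\<^sub>R p ^ k)"
      by (intro sum.cong refl) (simp add: f_def power_add[symmetric])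
    then show "(\<Sum>i\<le>k. f i * f (k - i))
        = (if k = 0 then 1 else if k = 1 then - 1 else 0) *\<^sub>R p ^ k"
      by (simp add: scaleR_sum_left[symmetric] sqrt_coeff_convolution)
  qed
  also have "suminf \<dots> = (\<Sum>k\<in>{0,1}. (if k = 0 then 1 else if k = 1 then - 1 else 0) *\<^sub>R p ^ k)"
    by (rule suminf_finite) auto
  also have "\<dots> = q" by (simp add: p_def)
  finally have h2: "h * h = q" .
  have sn': "summable (\<lambda>k. norm (f (Suc k)))"
    by (rule summable_Suc_iff[THEN iffD2, OF sn])
  have "1 - h = - (\<Sum>k. f (Suc k))"
    using suminf_split_head[OF sf] by (simp add: h_def f0)
  then have "norm (1 - h) \<le> (\<Sum>k. norm (f (Suc k)))"
    using summable_norm[of "\<lambda>k. f (Suc k)"] sn' by simp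
  also have "\<dots> \<le> (\<Sum>k. \<bar>sqrt_coeff (Suc k)\<bar>)"
    by (intro suminf_le summable_abs_sqrt_coeff_Suc f_le sn')
  finally have h3: "norm (1 - h) \<le> 1" using suminf_abs_sqrt_coeff by linarith
  show ?thesis by (rule that[OF h1 h2 h3 comm])
qed

text \<open>With \<open>h\<close> the square root of \<open>1 - k\<^sup>2\<close>, the element \<open>k + i h\<close> is unitary, hence of norm one,
  and \<open>h\<close> is its imaginary part.\<close>

lemma norm_one_minus_square:
  fixes k :: "'a::cstar_algebra"
  assumes "star k = k" "norm k \<le> 1"
  shows "norm (1 - k * k) \<le> 1"
proof -
  have "star (1 - k * k) = 1 - k * k" using assms(1) by (simp add: star_diff star_mult)
  moreover have "norm (1 - (1 - k * k)) \<le> 1"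
    using norm_square_self_adjoint[OF assms(1)] assms(2) by (simp add: power_le_one)
  ultimately obtain h where h: "star h = h" "h * h = 1 - k * k"
      and comm: "\<And>x. x * (1 - k * k) = (1 - k * k) * x \<Longrightarrow> x * h = h * x"
    using self_adjoint_sqrt by metis
  have kh: "k * h = h * k" by (rule comm) (simp add: algebra_simps)
  define u where "u = k + \<i> *\<^sub>C h"
  have su: "star u = k - \<i> *\<^sub>C h"
    by (simp add: u_def star_add star_scaleC h assms(1) scaleC_minus_left)
  have "star u * u = (k - \<i> *\<^sub>C h) * (k + \<i> *\<^sub>C h)"
    by (simp only: su) (simp only: u_def)
  also have "\<dots> = k * k + h * h"
    by (simp add: left_diff_distrib distrib_left mult_scaleC_left mult_scaleC_right
        scaleC_scaleC kh scaleC_minus_left scaleC_one scaleC_diff_right)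
  finally have "(norm u)\<^sup>2 = 1"
    using norm_star_mult_self[of u] by (simp add: h)
  then have "norm u = 1"
    using power2_eq_iff_nonneg[of "norm u" 1] by simp
  have "u - star u = (2 * \<i>) *\<^sub>C h"
    by (simp add: su, simp add: u_def flip: scaleC_add_left)
  then have "2 * norm h = norm (u - star u)" by (simp add: norm_scaleC norm_mult)
  also have "\<dots> \<le> 2" using norm_triangle_ineq4[of u "star u"] \<open>norm u = 1\<close> by simp
  finally have "norm h \<le> 1" by simp
  then show ?thesis using norm_square_self_adjoint[OF h(1)] h(2) by (simp add: power_le_one)
qed

lemma invertible_if_norm_one_minus_less:
  fixes x :: "'a::{real_normed_algebra_1,banach}"
  assumes "norm (1 - x) < 1"
  obtains y where "x * y = 1" "y * x = 1"
proof -
  define p where "p = 1 - x"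
  have s: "summable (\<lambda>n. p ^ n)"
    by (rule summable_norm_cancel, rule summable_comparison_test[OF _ summable_geometric])
      (use assms norm_power_ineq[of p] in \<open>auto simp: p_def\<close>)
  have S: "suminf (\<lambda>n. p ^ Suc n) = suminf (\<lambda>n. p ^ n) - 1"
    using suminf_split_head[OF s] by simp
  have "p * suminf (\<lambda>n. p ^ n) = suminf (\<lambda>n. p ^ n) - 1"
    using suminf_mult[OF s, of p] S by simp
  moreover have "suminf (\<lambda>n. p ^ n) * p = suminf (\<lambda>n. p ^ n) - 1"
    using suminf_mult2[OF s, of p] S by (simp add: power_commutes)
  moreover have x: "x = 1 - p" by (simp add: p_def)
  ultimately show ?thesis
    using that[of "suminf (\<lambda>n. p ^ n)"] unfolding x by (simp add: left_diff_distrib right_diff_distrib)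
qed

section \<open>The form defined by a faithful trace\<close>

lemma quadratic_discriminant:
  fixes a b c :: real
  assumes nonneg: "\<And>t. 0 \<le> a + 2 * t * b + t\<^sup>2 * c" and c: "0 \<le> c"
  shows "b\<^sup>2 \<le> a * c"
proof (cases "c = 0")
  case True
  have "b = 0"
  proof (rule ccontr)
    assume "b \<noteq> 0"
    with nonneg[of "- (a + 1) / (2 * b)"] True show False by (simp add: field_simps)
  qed
  then show ?thesis using True by simp
next
  case False
  then have "0 \<le> (a + 2 * (- b / c) * b + (- b / c)\<^sup>2 * c) * c"
    using nonneg[of "- b / c"] c by (intro mult_nonneg_nonneg) auto
  also have "\<dots> = a * c - b\<^sup>2"
    using False by (simp add: field_simps power2_eq_square)
  finally show ?thesis by simp
qed

locale faithful_trace =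
  fixes \<tau> :: "'a::cstar_algebra \<Rightarrow> complex"
  assumes trace: "faithful_tracial_state \<tau>"
begin

lemma trace_add: "\<tau> (x + y) = \<tau> x + \<tau> y"
  and trace_scaleC: "\<tau> (c *\<^sub>C x) = c * \<tau> x"
  and trace_one: "\<tau> 1 = 1"
  and trace_commute: "\<tau> (x * y) = \<tau> (y * x)"
  using trace by (auto simp: faithful_tracial_state_def)

lemma trace_star_mult_self: "0 \<le> Re (\<tau> (star x * x))" "Im (\<tau> (star x * x)) = 0"
  using trace by (auto simp: faithful_tracial_state_def complex_nonneg_Reals_iff)

lemma trace_scaleR: "\<tau> (r *\<^sub>R x) = r *\<^sub>R \<tau> x"
  unfolding scaleR_scaleC[of r x] trace_scaleC by (simp add: scaleR_conv_of_real)

lemma linear_trace: "linear \<tau>"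
  by (rule linearI) (simp_all add: trace_add trace_scaleR)

lemmas trace_zero = linear_0[OF linear_trace]
  and trace_diff = linear_diff[OF linear_trace]
  and trace_sum = linear_sum[OF linear_trace]

text \<open>The real part turns the inner product of the trace into a real bilinear form, to which
  the lemmas on \<open>bilinear\<close> apply. Nothing is lost for self-adjoint \<open>c\<close>,
  where the trace of \<open>star v * c * v\<close> is real.\<close>

definition ip :: "'a \<Rightarrow> 'a \<Rightarrow> real" where
  "ip v w = Re (\<tau> (star v * w))"

lemma bilinear_ip: "bilinear ip"
  unfolding bilinear_def
  by (auto intro!: linearI simp: ip_def star_add star_scaleR trace_add trace_scaleR
      distrib_left distrib_right)

lemma ip_commute: "ip v w = ip w v"
proof -
  \<comment> \<open>The trace of this square is real; its imaginary part is the antisymmetric part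
    of \<open>ip\<close>.\<close>
  have "star (v + \<i> *\<^sub>C w) * (v + \<i> *\<^sub>C w)
      = (star v * v + star w * w) + \<i> *\<^sub>C (star v * w - star w * v)"
    by (simp add: star_add star_scaleC scaleC_minus_left scaleC_scaleC scaleC_one scaleC_diff_right
        distrib_left left_diff_distrib mult_scaleC_left mult_scaleC_right)
  then have "Im (\<tau> (\<i> *\<^sub>C (star v * w - star w * v))) = 0"
    using trace_star_mult_self(2)[of "v + \<i> *\<^sub>C w"] trace_star_mult_self(2)[of v]
      trace_star_mult_self(2)[of w] by (simp add: trace_add)
  then show ?thesis by (simp add: ip_def trace_scaleC trace_diff)
qed

lemma ip_self_nonneg [simp]: "0 \<le> ip v v"
  by (simp add: ip_def trace_star_mult_self)

lemma ip_self_eq_0_iff [simp]: "ip v v = 0 \<longleftrightarrow> v = 0"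
proof
  assume "ip v v = 0"
  then have "\<tau> (star v * v) = 0"
    using trace_star_mult_self(2)[of v] by (simp add: ip_def complex_eq_iff)
  then show "v = 0" using trace by (auto simp: faithful_tracial_state_def)
qed (simp add: ip_def trace_zero)

lemma ip_mult: "ip v (a * w) = ip (star a * v) w"
  by (simp add: ip_def star_mult star_star mult.assoc)

text \<open>The element \<open>1 - c / norm c\<close> is the square of a self-adjoint element, so
  its form is nonnegative.\<close>

lemma ip_mult_le:
  assumes "star c = c"
  shows "ip v (c * v) \<le> norm c * ip v v"
proof (cases "c = 0")
  case True then show ?thesis by (simp add: bilinear_rzero[OF bilinear_ip])
next
  case False
  define q where "q = 1 - (1 / norm c) *\<^sub>R c"
  have "star q = q" by (simp add: q_def star_diff star_scaleR assms)
  moreover have "norm (1 - q) \<le> 1" by (simp add: q_def)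
  ultimately obtain h where h: "star h = h" "h * h = q"
    using self_adjoint_sqrt by metis
  have "0 \<le> ip (star h * v) (h * v)" by (simp add: h)
  also have "\<dots> = ip v (q * v)" by (simp only: ip_mult[symmetric] h(2)[symmetric] mult.assoc)
  also have "\<dots> = ip v v - (1 / norm c) * ip v (c * v)"
    by (simp add: q_def left_diff_distrib bilinear_rsub[OF bilinear_ip] bilinear_rmul[OF bilinear_ip])
  finally show ?thesis using False by (simp add: field_simps)
qed

lemma ip_mult_left_le: "ip (a * v) (a * v) \<le> (norm a)\<^sup>2 * ip v v"
proof -
  have "ip (a * v) (a * v) = ip v ((star a * a) * v)"
    by (simp add: ip_mult star_mult star_star mult.assoc)
  also have "\<dots> \<le> norm (star a * a) * ip v v"
    by (rule ip_mult_le) (simp add: star_mult star_star)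
  finally show ?thesis by (simp add: norm_star_mult_self)
qed

lemma ip_star: "ip (star v) (star v) = ip v v"
  by (simp add: ip_def star_star trace_commute)

text \<open>By the trace property \<open>star\<close> is isometric for \<open>ip\<close>, and it
  exchanges left and right multiplication.\<close>

lemma ip_mult_right_le: "ip (v * a) (v * a) \<le> (norm a)\<^sup>2 * ip v v"
  using ip_mult_left_le[of "star a" "star v"] ip_star[of "v * a"]
  by (simp add: star_mult ip_star)

text \<open>With \<open>m = |k|\<close> the positivity of the form of \<open>k\<close> forces \<open>g = m - k\<close>, twice the negative
  part of \<open>k\<close>, to satisfy \<open>m * g = 0\<close>, hence \<open>g = 0\<close> and \<open>norm (1 - k) \<le> 1\<close>.\<close>

lemma norm_one_minus_positive:
  assumes k: "star k = k" "norm k \<le> 1" and pos: "\<And>v. 0 \<le> ip v (k * v)"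
  shows "norm (1 - k) \<le> 1"
proof -
  have "star (k * k) = k * k" by (simp add: star_mult k)
  then obtain m where m: "star m = m" "m * m = k * k" "norm (1 - m) \<le> 1"
      and comm: "\<And>x. x * (k * k) = (k * k) * x \<Longrightarrow> x * m = m * x"
    using self_adjoint_sqrt norm_one_minus_square[OF k] by metis
  have km: "k * m = m * k" by (rule comm) (simp add: mult.assoc)
  obtain h where h: "star h = h" "h * h = m"
    using self_adjoint_sqrt[OF m(1) m(3)] by metis
  define g where "g = m - k"
  have kg: "k * g = - (m * g)" by (simp add: g_def right_diff_distrib km m)
  have "ip (h * g) (h * g) = ip (star h * g) (h * g)" by (simp add: h)
  also have "\<dots> = ip g (m * g)" by (simp only: ip_mult[symmetric] h(2)[symmetric] mult.assoc)
  also have "\<dots> = - ip g (k * g)" by (simp add: kg bilinear_rneg[OF bilinear_ip])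
  finally have "ip (h * g) (h * g) = 0"
    using pos[of g] ip_self_nonneg[of "h * g"] by linarith
  then have "h * g = 0" by simp
  then have mg: "m * g = 0" by (simp add: h(2)[symmetric] mult.assoc)
  have "star g * g = m * g - k * g" by (simp add: g_def star_diff m k left_diff_distrib)
  then have "star g * g = 0" using mg kg by simp
  then have "g = 0" using norm_star_mult_self[of g] by simp
  then show ?thesis using m(3) by (simp add: g_def)
qed

text \<open>After subtracting \<open>\<epsilon>\<close> and scaling, positivity gives
  \<open>norm (1 - k) \<le> 1\<close>; adding \<open>\<epsilon>\<close> back brings a multiple of
  \<open>c\<close> strictly within distance one of the identity, where the Neumann series
  converges.\<close>

lemma invertible_if_form_bounded_below:
  assumes c: "star c = c" and "0 < \<epsilon>" and form: "\<And>v. \<epsilon> * ip v v \<le> ip v (c * v)"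
  obtains d where "c * d = 1" "d * c = 1"
proof -
  define k0 where "k0 = c - \<epsilon> *\<^sub>R 1"
  define K where "K = norm k0 + 1"
  define k where "k = (1 / K) *\<^sub>R k0"
  have K: "0 < K" by (simp add: K_def add_nonneg_pos)
  have "star k = k" by (simp add: k_def k0_def star_scaleR star_diff c)
  moreover have "norm k \<le> 1"
    unfolding k_def norm_scaleR using K by (simp add: K_def field_simps)
  moreover have "0 \<le> ip v (k * v)" for v
    using form[of v] K
    by (simp add: k_def k0_def left_diff_distrib bilinear_rsub[OF bilinear_ip]
        bilinear_rmul[OF bilinear_ip])
  ultimately have k1: "norm (1 - k) \<le> 1" by (rule norm_one_minus_positive)
  define x where "x = (1 / (K + \<epsilon>)) *\<^sub>R c"
  have "c = K *\<^sub>R k + \<epsilon> *\<^sub>R 1" using K by (simp add: k_def k0_def)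
  moreover have "(K + \<epsilon>) *\<^sub>R x = c" using K \<open>0 < \<epsilon>\<close> by (simp add: x_def)
  ultimately have "(K + \<epsilon>) *\<^sub>R (1 - x) = K *\<^sub>R (1 - k)"
    by (simp add: scaleR_right_diff_distrib scaleR_left_distrib)
  then have "norm ((K + \<epsilon>) *\<^sub>R (1 - x)) = K * norm (1 - k)"
    using K by simp
  then have "(K + \<epsilon>) * norm (1 - x) \<le> K" using K \<open>0 < \<epsilon>\<close> k1 by simp
  then have "norm (1 - x) \<le> K / (K + \<epsilon>)"
    using K \<open>0 < \<epsilon>\<close> by (simp add: pos_le_divide_eq mult.commute)
  also have "\<dots> < 1" using K \<open>0 < \<epsilon>\<close> by simp
  finally have "norm (1 - x) < 1" .
  then obtain y where "x * y = 1" "y * x = 1" by (rule invertible_if_norm_one_minus_less)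
  then show ?thesis
    using that[of "(1 / (K + \<epsilon>)) *\<^sub>R y"] by (simp add: x_def)
qed

text \<open>Gaussian elimination: the Schur complement inherits the lower bound of the form.\<close>

lemma solvable_if_form_bounded_below:
  fixes A :: "'d \<Rightarrow> 'd \<Rightarrow> 'a"
  assumes "finite I" "0 < \<epsilon>"
    and "\<And>i j. star (A i j) = A j i"
    and "\<And>v. \<epsilon> * (\<Sum>i\<in>I. ip (v i) (v i)) \<le> (\<Sum>i\<in>I. ip (v i) (\<Sum>j\<in>I. A i j * v j))"
  shows "\<exists>v. \<forall>i\<in>I. (\<Sum>j\<in>I. A i j * v j) = w i"
  using assms(1,3,4)
proof (induction I arbitrary: A w rule: finite_induct)
  case empty
  then show ?case by simp
next
  case (insert p J A w)
  note sa = insert.prems(1) and form = insert.prems(2)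
  have "\<epsilon> * ip x x \<le> ip x (A p p * x)" for x
  proof -
    have if_zero: "(if P then x else 0) * y = (if P then x * y else 0)"
      "y * (if P then x else 0) = (if P then y * x else 0)"
      "ip (if P then x else 0) z = (if P then ip x z else 0)" for P x z and y :: 'a
      by (simp_all add: bilinear_lzero[OF bilinear_ip])
    have "(\<Sum>i\<in>insert p J. ip (if i = p then x else 0) (if i = p then x else 0)) = ip x x"
      using insert.hyps by (simp add: if_zero sum.delta)
    moreover have "(\<Sum>i\<in>insert p J. ip (if i = p then x else 0)
        (\<Sum>j\<in>insert p J. A i j * (if j = p then x else 0))) = ip x (A p p * x)"
      using insert.hyps by (simp add: if_zero sum.delta)
    ultimately show ?thesis using form[of "\<lambda>i. if i = p then x else 0"] by metis
  qed
  then obtain \<beta> where \<beta>: "A p p * \<beta> = 1" "\<beta> * A p p = 1"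
    using invertible_if_form_bounded_below[OF sa[of p p] \<open>0 < \<epsilon>\<close>] by metis
  have "star \<beta> * A p p = 1"
    using arg_cong[OF \<beta>(1), of star] by (simp add: star_mult sa)
  then have s\<beta>: "star \<beta> = \<beta>"
    by (metis \<beta>(1) mult.assoc mult.left_neutral mult.right_neutral)
  define A' where "A' i j = A i j - A i p * \<beta> * A p j" for i j
  have sa': "star (A' i j) = A' j i" for i j
    by (simp add: A'_def star_diff star_mult sa s\<beta> mult.assoc)
  have A'_sum: "(\<Sum>j\<in>J. A' i j * v j) = (\<Sum>j\<in>J. A i j * v j) - A i p * \<beta> * (\<Sum>j\<in>J. A p j * v j)"
    for v i
    by (simp add: A'_def left_diff_distrib sum_subtractf sum_distrib_left mult.assoc)
  have "\<epsilon> * (\<Sum>i\<in>J. ip (v i) (v i)) \<le> (\<Sum>i\<in>J. ip (v i) (\<Sum>j\<in>J. A' i j * v j))" for v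
  proof -
    \<comment> \<open>This coordinate annihilates row \<open>p\<close>, so that the form of
      \<open>A\<close> at \<open>u\<close> equals the form of the Schur complement at
      \<open>v\<close>.\<close>
    define u where "u = v(p := - (\<beta> * (\<Sum>j\<in>J. A p j * v j)))"
    have u: "u i = v i" if "i \<in> J" for i using that insert.hyps by (auto simp: u_def)
    have up: "u p = - (\<beta> * (\<Sum>j\<in>J. A p j * v j))" by (simp add: u_def)
    have Au: "(\<Sum>j\<in>insert p J. A i j * u j) = A i p * u p + (\<Sum>j\<in>J. A i j * v j)" for i
      using insert.hyps by (simp add: u cong: sum.cong)
    have Aup: "(\<Sum>j\<in>insert p J. A p j * u j) = 0"
      unfolding Au by (simp add: up \<beta> flip: mult.assoc)
    have Aui: "(\<Sum>j\<in>insert p J. A i j * u j) = (\<Sum>j\<in>J. A' i j * v j)" for i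
      unfolding Au A'_sum by (simp add: up mult.assoc)
    have "\<epsilon> * (\<Sum>i\<in>J. ip (v i) (v i)) \<le> \<epsilon> * (\<Sum>i\<in>insert p J. ip (u i) (u i))"
      using insert.hyps \<open>0 < \<epsilon>\<close> by (simp add: u cong: sum.cong)
    also have "\<dots> \<le> (\<Sum>i\<in>insert p J. ip (u i) (\<Sum>j\<in>insert p J. A i j * u j))" by (rule form)
    also have "\<dots> = (\<Sum>i\<in>J. ip (u i) (\<Sum>j\<in>insert p J. A i j * u j))"
      using insert.hyps Aup by (simp add: bilinear_rzero[OF bilinear_ip])
    also have "\<dots> = (\<Sum>i\<in>J. ip (v i) (\<Sum>j\<in>J. A' i j * v j))"
      by (simp only: Aui) (simp add: u cong: sum.cong)
    finally show ?thesis .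
  qed
  from insert.IH[OF sa' this, of "\<lambda>i. w i - A i p * \<beta> * w p"]
  obtain v where v: "\<And>i. i \<in> J \<Longrightarrow> (\<Sum>j\<in>J. A' i j * v j) = w i - A i p * \<beta> * w p"
    by metis
  define u where "u = v(p := \<beta> * (w p - (\<Sum>j\<in>J. A p j * v j)))"
  have u: "u i = v i" if "i \<in> J" for i using that insert.hyps by (auto simp: u_def)
  have up: "u p = \<beta> * (w p - (\<Sum>j\<in>J. A p j * v j))" by (simp add: u_def)
  have Au: "(\<Sum>j\<in>insert p J. A i j * u j) = A i p * u p + (\<Sum>j\<in>J. A i j * v j)" for i
    using insert.hyps by (simp add: u cong: sum.cong)
  have "(\<Sum>j\<in>insert p J. A i j * u j) = w i" if "i \<in> insert p J" for i
  proof (cases "i = p")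
    case True
    then show ?thesis unfolding Au by (simp add: up \<beta> flip: mult.assoc)
  next
    case False
    then have "(\<Sum>j\<in>J. A i j * v j) = w i - A i p * \<beta> * w p + A i p * \<beta> * (\<Sum>j\<in>J. A p j * v j)"
      using v[of i] that unfolding A'_sum by (simp add: algebra_simps)
    then show ?thesis unfolding Au by (simp add: up right_diff_distrib mult.assoc)
  qed
  then show ?case by metis
qed

end

section \<open>The numerical range and the spectrum\<close>

lemma mat_star_mat_star [simp]: "mat_star (mat_star A) = A"
  by (simp add: mat_star_def vec_eq_iff star_star)

lemma mat_star_nth [simp]: "mat_star A $ i $ j = star (A $ j $ i)"
  by (simp add: mat_star_def)

lemma mat_star_zero [simp]: "mat_star 0 = 0"
  by (simp add: vec_eq_iff)

lemma mat_star_add: "mat_star (A + B) = mat_star A + mat_star B"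
  by (simp add: vec_eq_iff star_add)

lemma mat_star_diff: "mat_star (A - B) = mat_star A - mat_star B"
  by (simp add: vec_eq_iff star_diff)

lemma mat_star_minus: "mat_star (- A) = - mat_star A"
  by (simp add: vec_eq_iff star_minus)

lemma mat_star_sum: "mat_star (sum f I) = (\<Sum>i\<in>I. mat_star (f i))"
  by (induction I rule: infinite_finite_induct) (simp_all add: mat_star_add)

lemma mat_star_mult:
  fixes A :: "'a::cstar_algebra^'m^'d" and B :: "'a^'k^'m"
  shows "mat_star (A ** B) = mat_star B ** mat_star A"
  by (simp add: vec_eq_iff matrix_matrix_mult_def star_sum star_mult)

lemma mat_star_mat: "mat_star (mat c) = mat (star c)"
  by (simp add: vec_eq_iff mat_def)

lemma mat_scaleR_mult_vec: "mat (r *\<^sub>R 1) *v (v :: 'a::real_algebra_1^'d) = r *\<^sub>R v"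
  by (simp add: vec_eq_iff matrix_vector_mult_def mat_def if_distrib if_distribR
      cong del: if_weak_cong)

lemma matrix_vector_mult_axis_nth:
  fixes A :: "'a::semiring_1^'m^'d"
  shows "(A *v axis j x) $ i = A $ i $ j * x"
  by (simp add: matrix_vector_mult_def axis_def if_distrib if_distribR
      cong del: if_weak_cong)

lemma matrix_minus_mult_vec: "(- A) *v v = - (A *v (v :: 'a::ring_1^'m))"
  using matrix_vector_mult_diff_rdistrib[of 0 A v] by simp

lemma invertible_minus_iff: "invertible (- A) \<longleftrightarrow> invertible (A :: 'a::ring_1^'d^'d)"
proof -
  have neg: "(- X) ** (- Y) = X ** Y" for X Y :: "'a^'d^'d"
    by (simp add: vec_eq_iff matrix_matrix_mult_def)
  show ?thesis unfolding invertible_def by (metis minus_minus neg)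
qed

context faithful_trace
begin

definition inn :: "'a^'d \<Rightarrow> 'a^'d \<Rightarrow> real" where
  "inn v w = (\<Sum>i\<in>UNIV. ip (v $ i) (w $ i))"

lemma bilinear_inn: "bilinear inn"
  unfolding bilinear_def inn_def
  by (auto intro!: linearI simp: bilinear_ladd[OF bilinear_ip] bilinear_radd[OF bilinear_ip]
      bilinear_lmul[OF bilinear_ip] bilinear_rmul[OF bilinear_ip] sum.distrib sum_distrib_left)

lemmas inn_simps = bilinear_ladd[OF bilinear_inn] bilinear_radd[OF bilinear_inn]
  bilinear_lsub[OF bilinear_inn] bilinear_rsub[OF bilinear_inn]
  bilinear_lneg[OF bilinear_inn] bilinear_rneg[OF bilinear_inn]
  bilinear_lmul[OF bilinear_inn] bilinear_rmul[OF bilinear_inn]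
  bilinear_lzero[OF bilinear_inn] bilinear_rzero[OF bilinear_inn]

lemma inn_commute: "inn v w = inn w v"
  by (simp add: inn_def ip_commute)

lemma inn_self_nonneg [simp]: "0 \<le> inn v v"
  by (simp add: inn_def sum_nonneg)

lemma inn_self_eq_0_iff [simp]: "inn v v = 0 \<longleftrightarrow> v = 0"
  by (simp add: inn_def sum_nonneg_eq_0_iff vec_eq_iff)

lemma inn_self_pos: "v \<noteq> 0 \<Longrightarrow> 0 < inn v v"
  using inn_self_nonneg[of v] inn_self_eq_0_iff[of v] by (simp add: less_le)

lemma inn_axis: "inn (axis i x) (axis i x) = ip x x"
proof -
  have "inn (axis i x) (axis i x) = (\<Sum>j\<in>UNIV. if j = i then ip x x else 0)"
    unfolding inn_def by (intro sum.cong refl) (simp add: axis_def)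
  then show ?thesis by simp
qed

lemma ip_sum_right: "ip v (sum f I) = (\<Sum>i\<in>I. ip v (f i))"
  by (simp add: ip_def sum_distrib_left trace_sum)

lemma ip_sum_left: "ip (sum f I) v = (\<Sum>i\<in>I. ip (f i) v)"
  by (simp add: ip_commute[of _ v] ip_sum_right)

lemma inn_mat_star: "inn (mat_star A *v v) w = inn v (A *v w)"
proof -
  have "inn (mat_star A *v v) w = (\<Sum>i\<in>UNIV. \<Sum>j\<in>UNIV. ip (v $ j) (A $ j $ i * w $ i))"
    by (simp add: inn_def matrix_vector_mult_def ip_sum_left ip_mult)
  also have "\<dots> = (\<Sum>j\<in>UNIV. \<Sum>i\<in>UNIV. ip (v $ j) (A $ j $ i * w $ i))"
    by (rule sum.swap)
  finally show ?thesis by (simp add: inn_def matrix_vector_mult_def ip_sum_right)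
qed

lemma form_Cauchy_Schwarz:
  fixes P :: "'a^'d^'d"
  assumes P: "mat_star P = P" and pos: "\<And>v. 0 \<le> inn v (P *v v)"
  shows "(inn v (P *v w))\<^sup>2 \<le> inn v (P *v v) * inn w (P *v w)"
proof (rule quadratic_discriminant)
  fix t :: real
  have sym: "inn w (P *v v) = inn v (P *v w)"
    using inn_mat_star[of P w v] by (simp add: P inn_commute)
  have "0 \<le> inn (v + t *\<^sub>R w) (P *v (v + t *\<^sub>R w))" by (rule pos)
  also have "P *v (v + t *\<^sub>R w) = P *v v + t *\<^sub>R (P *v w)"
    by (simp add: matrix_vector_right_distrib linear_cmul[OF matrix_vector_mul_linear])
  finally show "0 \<le> inn v (P *v v) + 2 * t * inn v (P *v w) + t\<^sup>2 * inn w (P *v w)"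
    by (simp add: inn_simps sym power2_eq_square algebra_simps)
qed (rule pos)

lemma inn_Cauchy_Schwarz: "(inn v w)\<^sup>2 \<le> inn v v * inn w w"
  using form_Cauchy_Schwarz[of "mat 1" v w] by (simp add: mat_star_mat)

definition nrm :: "'a^'d \<Rightarrow> real" where
  "nrm v = sqrt (inn v v)"

lemma nrm_nonneg [simp]: "0 \<le> nrm v"
  by (simp add: nrm_def)

lemma nrm_square: "(nrm v)\<^sup>2 = inn v v"
  by (simp add: nrm_def)

lemma nrm_zero [simp]: "nrm 0 = 0"
  by (simp add: nrm_def inn_simps)

lemma inn_le_nrm: "\<bar>inn v w\<bar> \<le> nrm v * nrm w"
  using inn_Cauchy_Schwarz[of v w]
  by (simp add: nrm_def real_le_rsqrt flip: real_sqrt_mult)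

lemma nrm_triangle: "nrm (v + w) \<le> nrm v + nrm w"
proof (rule power2_le_imp_le)
  show "(nrm (v + w))\<^sup>2 \<le> (nrm v + nrm w)\<^sup>2"
    using inn_le_nrm[of v w]
    by (simp add: nrm_square power2_sum inn_simps inn_commute[of w v])
qed simp

lemma nrm_sum: "nrm (sum f I) \<le> (\<Sum>i\<in>I. nrm (f i))"
proof (induction I rule: infinite_finite_induct)
  case (insert x F)
  then show ?case using nrm_triangle[of "f x" "sum f F"] by simp
qed simp_all

lemma ip_nth_le: "ip (v $ j) (v $ j) \<le> inn v v"
  unfolding inn_def by (rule member_le_sum) auto

lemma nrm_mult_le: "nrm (A *v v) \<le> (\<Sum>j\<in>UNIV. \<Sum>i\<in>UNIV. norm (A $ i $ j)) * nrm v"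
proof -
  have Av: "A *v v = (\<Sum>j\<in>UNIV. \<Sum>i\<in>UNIV. axis i (A $ i $ j * v $ j))"
    by (simp add: vec_eq_iff matrix_vector_mult_def axis_def)
  have "nrm (A *v v) \<le> (\<Sum>j\<in>UNIV. \<Sum>i\<in>UNIV. nrm (axis i (A $ i $ j * v $ j)))"
    unfolding Av by (rule order_trans[OF nrm_sum sum_mono[OF nrm_sum]])
  also have "\<dots> \<le> (\<Sum>j\<in>UNIV. \<Sum>i\<in>UNIV. norm (A $ i $ j) * nrm v)"
  proof (intro sum_mono)
    fix i j
    have "inn (axis i (A $ i $ j * v $ j)) (axis i (A $ i $ j * v $ j))
        \<le> (norm (A $ i $ j))\<^sup>2 * ip (v $ j) (v $ j)"
      unfolding inn_axis by (rule ip_mult_left_le)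
    also have "\<dots> \<le> (norm (A $ i $ j))\<^sup>2 * inn v v"
      by (intro mult_left_mono ip_nth_le) auto
    finally show "nrm (axis i (A $ i $ j * v $ j)) \<le> norm (A $ i $ j) * nrm v"
      by (simp add: nrm_def real_le_lsqrt power_mult_distrib)
  qed
  finally show ?thesis by (simp add: sum_distrib_right)
qed

lemma matrix_bounded: obtains K where "0 < K" "\<And>v. nrm (A *v v) \<le> K * nrm v"
proof
  let ?K = "(\<Sum>j\<in>UNIV. \<Sum>i\<in>UNIV. norm (A $ i $ j))"
  have "0 \<le> ?K" by (intro sum_nonneg) auto
  then show "0 < ?K + 1" by simp
  show "nrm (A *v v) \<le> (?K + 1) * nrm v" for v
    by (rule order_trans[OF nrm_mult_le]) (intro mult_right_mono, auto)
qed

lemma form_bounded: obtains K where "0 < K" "\<And>v. \<bar>inn v (A *v v)\<bar> \<le> K * inn v v"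
proof -
  obtain K where K: "0 < K" "\<And>v. nrm (A *v v) \<le> K * nrm v" using matrix_bounded[of A] by metis
  have "\<bar>inn v (A *v v)\<bar> \<le> K * inn v v" for v
    using order_trans[OF inn_le_nrm[of v "A *v v"] mult_left_mono[OF K(2)[of v] nrm_nonneg[of v]]]
    by (simp add: mult_ac power2_eq_square flip: nrm_square)
  then show ?thesis using that K(1) by blast
qed

text \<open>Solving for the unit vectors gives the columns of a right inverse; its adjoint is a left
  inverse since \<open>A\<close> is self-adjoint.\<close>

lemma matrix_invertible_if_form_bounded_below:
  fixes A :: "'a^'d^'d"
  assumes A: "mat_star A = A" and "0 < \<epsilon>" and form: "\<And>v. \<epsilon> * inn v v \<le> inn v (A *v v)"
  shows "invertible A"
proof -
  have "\<exists>v. \<forall>i\<in>UNIV. (\<Sum>j\<in>UNIV. A $ i $ j * v j) = w i" for w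
  proof (rule solvable_if_form_bounded_below[OF _ \<open>0 < \<epsilon>\<close>])
    show "star (A $ i $ j) = A $ j $ i" for i j using A by (metis mat_star_nth)
    show "\<epsilon> * (\<Sum>i\<in>UNIV. ip (v i) (v i))
        \<le> (\<Sum>i\<in>UNIV. ip (v i) (\<Sum>j\<in>UNIV. A $ i $ j * v j))" for v
      using form[of "vec_lambda v"] by (simp add: inn_def matrix_vector_mult_def)
  qed simp
  then have "\<forall>k. \<exists>v. \<forall>i. (\<Sum>j\<in>UNIV. A $ i $ j * v j) = mat 1 $ i $ k" by simp
  then obtain V where V: "\<And>k i. (\<Sum>j\<in>UNIV. A $ i $ j * V k j) = mat 1 $ i $ k" by metis
  define B where "B = (\<chi> j k. V k j)"
  have AB: "A ** B = mat 1" by (simp add: vec_eq_iff matrix_matrix_mult_def B_def V)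
  have BA: "mat_star B ** A = mat 1"
    using arg_cong[OF AB, of mat_star] by (simp add: mat_star_mult A mat_star_mat)
  then have "B = mat_star B"
    by (metis AB matrix_mul_assoc matrix_mul_lid matrix_mul_rid)
  then show ?thesis using AB BA by (metis invertible_def)
qed

text \<open>Cauchy--Schwarz for the form of \<open>A\<close> at \<open>v\<close> and
  \<open>B *v v\<close>, with \<open>B\<close> the inverse, bounds the square of
  \<open>inn v v\<close> by the form of \<open>A\<close> at \<open>v\<close> times the bounded form
  of \<open>B\<close>.\<close>

lemma form_bounded_below_if_invertible:
  fixes A :: "'a^'d^'d"
  assumes A: "mat_star A = A" and pos: "\<And>v. 0 \<le> inn v (A *v v)" and "invertible A"
  obtains \<epsilon> where "0 < \<epsilon>" "\<And>v. \<epsilon> * inn v v \<le> inn v (A *v v)"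
proof -
  obtain B where AB: "A ** B = mat 1" using \<open>invertible A\<close> by (auto simp: invertible_def)
  obtain K where K: "0 < K" "\<And>v. \<bar>inn v (B *v v)\<bar> \<le> K * inn v v" using form_bounded[of B] by metis
  have "inn v v \<le> K * inn v (A *v v)" for v
  proof (cases "v = 0")
    case True then show ?thesis by (simp add: inn_simps)
  next
    case False
    then have v: "0 < inn v v" by (rule inn_self_pos)
    have ABv: "A *v (B *v v) = v" by (simp add: matrix_vector_mul_assoc AB)
    have BvK: "inn (B *v v) v \<le> K * inn v v"
      using K(2)[of v] unfolding inn_commute[of "B *v v" v] by (simp add: abs_le_iff)
    have "(inn v v)\<^sup>2 \<le> inn v (A *v v) * inn (B *v v) v"
      using form_Cauchy_Schwarz[OF A pos, of v "B *v v"] by (simp add: ABv)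
    also have "\<dots> \<le> inn v (A *v v) * (K * inn v v)"
      by (rule mult_left_mono[OF BvK pos])
    finally have "inn v v * inn v v \<le> (K * inn v (A *v v)) * inn v v"
      by (simp add: power2_eq_square mult_ac)
    then show ?thesis using v by simp
  qed
  then have "(1 / K) * inn v v \<le> inn v (A *v v)" for v
    using K(1) by (simp add: field_simps)
  then show ?thesis using that[of "1 / K"] K(1) by simp
qed

lemma spectrum_real_iff:
  "complex_of_real t \<in> spectrum A \<longleftrightarrow> \<not> invertible (mat (t *\<^sub>R 1) - (A :: 'a^'d^'d))"
  by (simp add: spectrum_def scaleR_scaleC[of t "1::'a"])

text \<open>The least upper bound \<open>T\<close> of the form lies in the spectrum: if
  \<open>T - A\<close> were invertible, its form would be bounded below and \<open>T\<close> could
  be lowered. Beyond \<open>T\<close> the form of \<open>t - A\<close> is bounded below, so that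
  nothing of the spectrum lies there.\<close>

lemma lambda_max_le_iff:
  fixes A :: "'a^'d^'d"
  assumes A: "mat_star A = A"
  shows "lambda_max A \<le> t \<longleftrightarrow> (\<forall>v. inn v (A *v v) \<le> t * inn v v)"
proof -
  define S where "S = {t. \<forall>v. inn v (A *v v) \<le> t * inn v v}"
  define T where "T = Inf S"
  let ?B = "\<lambda>t. mat (t *\<^sub>R 1) - A"
  obtain K where K: "\<And>v. \<bar>inn v (A *v v)\<bar> \<le> K * inn v v" using form_bounded[of A] by metis
  have B: "mat_star (?B t) = ?B t" for t
    by (simp add: mat_star_diff mat_star_mat star_scaleR A)
  have B_form: "inn v (?B t *v v) = t * inn v v - inn v (A *v v)" for t v
    by (simp add: matrix_vector_mult_diff_rdistrib mat_scaleR_mult_vec inn_simps)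
  have KS: "K \<in> S" unfolding S_def using K abs_le_D1 by blast
  \<comment> \<open>Any vector of length one shows that \<open>S\<close> is bounded below, so that
    \<open>Inf S\<close> is meaningful.\<close>
  let ?e = "axis undefined 1 :: 'a^'d"
  have e: "inn ?e ?e = 1" by (simp add: inn_axis ip_def trace_one)
  have S_ge: "inn ?e (A *v ?e) \<le> t" if "t \<in> S" for t
  proof -
    have "inn ?e (A *v ?e) \<le> t * inn ?e ?e" using that unfolding S_def by blast
    then show ?thesis by (simp add: e)
  qed
  have bdd: "bdd_below S" using S_ge by (rule bdd_belowI)
  have S_up: "t \<in> S" if "T < t" for t
  proof -
    have "S \<noteq> {}" using KS by auto
    moreover have "Inf S < t" using that by (simp only: T_def)
    ultimately obtain s where s: "s \<in> S" "s < t" by (meson cInf_lessD)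
    have "inn v (A *v v) \<le> t * inn v v" for v
    proof -
      have "inn v (A *v v) \<le> s * inn v v" using s(1) unfolding S_def by blast
      also have "\<dots> \<le> t * inn v v" using s(2) by (intro mult_right_mono) auto
      finally show ?thesis .
    qed
    then show ?thesis by (simp add: S_def)
  qed
  have TS: "T \<in> S"
  proof -
    have "inn v (A *v v) \<le> T * inn v v" for v
    proof (rule ccontr)
      assume neg: "\<not> ?thesis"
      then have "v \<noteq> 0" by (auto simp: inn_simps)
      then have v: "0 < inn v v" by (rule inn_self_pos)
      have "T < inn v (A *v v) / inn v v" using neg v by (simp add: pos_less_divide_eq)
      then obtain t where t: "T < t" "t < inn v (A *v v) / inn v v" using dense by blast
      have "inn v (A *v v) \<le> t * inn v v" using S_up[OF t(1)] by (simp add: S_def)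
      then show False using t(2) v by (simp add: pos_less_divide_eq)
    qed
    then show ?thesis by (simp add: S_def)
  qed
  have S_iff: "t \<in> S \<longleftrightarrow> T \<le> t" for t
  proof
    assume "t \<in> S"
    then show "T \<le> t" unfolding T_def by (rule cInf_lower[OF _ bdd])
  next
    assume "T \<le> t"
    then show "t \<in> S" using S_up[of t] TS by (cases "T = t") auto
  qed
  have "complex_of_real T \<in> spectrum A"
  proof (rule ccontr)
    assume "\<not> ?thesis"
    then have "invertible (?B T)" by (simp add: spectrum_real_iff)
    moreover have "0 \<le> inn v (?B T *v v)" for v using TS by (simp add: B_form S_def)
    ultimately obtain \<epsilon> where \<epsilon>: "0 < \<epsilon>" "\<And>v. \<epsilon> * inn v v \<le> inn v (?B T *v v)"
      using form_bounded_below_if_invertible[OF B] by metis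
    have "T - \<epsilon> \<in> S" unfolding S_def
    proof safe
      fix v
      show "inn v (A *v v) \<le> (T - \<epsilon>) * inn v v"
        using \<epsilon>(2)[of v] unfolding B_form by (simp add: left_diff_distrib)
    qed
    then show False using \<epsilon>(1) by (simp add: S_iff)
  qed
  moreover have "t \<le> T" if "complex_of_real t \<in> spectrum A" for t
  proof (rule ccontr)
    assume "\<not> t \<le> T"
    then have "invertible (?B t)"
      using TS by (intro matrix_invertible_if_form_bounded_below[OF B, of "t - T"])
        (auto simp: B_form S_def left_diff_distrib)
    then show False using that by (simp add: spectrum_real_iff)
  qed
  ultimately have "lambda_max A = T"
    unfolding lambda_max_def by (intro cSup_eq_maximum) auto
  then show ?thesis using S_iff[of t] by (simp add: S_def)
qed

lemma lambda_min_eq: "lambda_min A = - lambda_max (- (A :: 'a^'d^'d))"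
proof -
  have neg: "- (mat (t *\<^sub>R 1) - A) = mat (- t *\<^sub>R 1) - - A" for t
    by (simp add: vec_eq_iff mat_def)
  have "complex_of_real (- t) \<in> spectrum (- A) \<longleftrightarrow> complex_of_real t \<in> spectrum A" for t
    using invertible_minus_iff[of "mat (t *\<^sub>R 1) - A"] unfolding neg spectrum_real_iff by simp
  then have "{t. complex_of_real t \<in> spectrum (- A)} = uminus ` {t. complex_of_real t \<in> spectrum A}"
    by (auto simp: image_iff) (metis minus_minus of_real_minus)
  then show ?thesis by (simp add: lambda_min_def lambda_max_def Inf_real_def)
qed

lemma lambda_min_ge_iff:
  fixes A :: "'a^'d^'d"
  assumes A: "mat_star A = A"
  shows "t \<le> lambda_min A \<longleftrightarrow> (\<forall>v. t * inn v v \<le> inn v (A *v v))"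
proof -
  have "t \<le> lambda_min A \<longleftrightarrow> lambda_max (- A) \<le> - t" by (simp add: lambda_min_eq) linarith
  also have "\<dots> \<longleftrightarrow> (\<forall>v. t * inn v v \<le> inn v (A *v v))"
    using lambda_max_le_iff[of "- A" "- t"]
    by (simp add: mat_star_minus A matrix_minus_mult_vec inn_simps)
  finally show ?thesis .
qed

end

section \<open>Form bounds from invariant subspaces\<close>

context faithful_trace
begin

definition rmul :: "'a^'d \<Rightarrow> 'a \<Rightarrow> 'a^'d" where
  "rmul v x = (\<chi> i. v $ i * x)"

lemma nrm_rmul_le: "nrm (rmul v x) \<le> norm x * nrm v"
proof -
  have "inn (rmul v x) (rmul v x) \<le> (\<Sum>i\<in>UNIV. (norm x)\<^sup>2 * ip (v $ i) (v $ i))"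
    unfolding inn_def rmul_def by (intro sum_mono) (simp add: ip_mult_right_le)
  also have "\<dots> = (norm x)\<^sup>2 * inn v v" by (simp add: inn_def sum_distrib_left)
  finally show ?thesis by (simp add: nrm_def real_le_lsqrt power_mult_distrib)
qed

lemma matrix_mult_rmul: "A *v rmul v x = rmul (A *v v) x"
  by (simp add: vec_eq_iff matrix_vector_mult_def rmul_def sum_distrib_right mult.assoc)

lemma inn_funpow:
  assumes A: "mat_star A = A"
  shows "inn v ((((*v) A) ^^ (2 * k)) v) = inn ((((*v) A) ^^ k) v) ((((*v) A) ^^ k) v)"
proof -
  have "inn ((((*v) A) ^^ k) w) u = inn w ((((*v) A) ^^ k) u)" for w u
  proof (induction k arbitrary: u)
    case (Suc k)
    have "inn (A *v (((*v) A) ^^ k) w) u = inn ((((*v) A) ^^ k) w) (A *v u)"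
      using inn_mat_star[of A] by (simp add: A)
    then show ?case using Suc[of "A *v u"] by (simp add: funpow_swap1)
  qed simp
  then show ?thesis by (simp add: mult_2 funpow_add)
qed

text \<open>A bound on a form need only be checked on a subspace \<open>F\<close> that is invariant and contains the
  basis vectors: by traciality right multiplication is bounded, so that the bound on \<open>F\<close> controls
  the growth of \<open>A\<^sup>k v\<close> for every \<open>v\<close>, and by the Cauchy--Schwarz inequality this growth controls
  the form.\<close>

lemma form_le_if_form_le_on_cyclic:
  fixes A :: "'a^'d^'d"
  assumes A: "mat_star A = A" and \<rho>: "0 < \<rho>"
    and F_sub: "\<And>r v w. v \<in> F \<Longrightarrow> w \<in> F \<Longrightarrow> v - r *\<^sub>R w \<in> F"
    and F_inv: "\<And>v. v \<in> F \<Longrightarrow> A *v v \<in> F"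
    and F_axis: "\<And>i. axis i 1 \<in> F"
    and lower: "\<And>v. v \<in> F \<Longrightarrow> 0 \<le> inn v (A *v v)"
    and upper: "\<And>v. v \<in> F \<Longrightarrow> inn v (A *v v) \<le> \<rho> * inn v v"
  shows "inn v (A *v v) \<le> \<rho> * inn v v"
proof (rule ccontr)
  let ?P = "\<lambda>k. ((*v) A) ^^ k"
  have sym: "inn (A *v v) w = inn v (A *v w)" for v w
    using inn_mat_star[of A v w] by (simp add: A)
  have bound: "nrm (A *v v) \<le> \<rho> * nrm v" if v: "v \<in> F" for v
  proof -
    let ?n = "inn (A *v v) (A *v v)"
    \<comment> \<open>Positivity at this combination, with the upper bound at \<open>A *v v\<close>,
      says that the square of \<open>A\<close> is at most \<open>\<rho>\<close> times
      \<open>A\<close> on \<open>F\<close>.\<close>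
    have "0 \<le> inn (v - (1 / \<rho>) *\<^sub>R (A *v v)) (A *v (v - (1 / \<rho>) *\<^sub>R (A *v v)))"
      by (intro lower F_sub v F_inv)
    also have "\<dots> = inn v (A *v v) - 2 / \<rho> * ?n + (1 / \<rho>)\<^sup>2 * inn (A *v v) (A *v (A *v v))"
      by (simp add: matrix_vector_mult_diff_distrib linear_cmul[OF matrix_vector_mul_linear]
          inn_simps sym power2_eq_square diff_divide_distrib)
    also have "\<dots> \<le> inn v (A *v v) - 2 / \<rho> * ?n + (1 / \<rho>)\<^sup>2 * (\<rho> * ?n)"
      by (intro add_left_mono mult_left_mono upper F_inv v) simp
    also have "\<dots> = inn v (A *v v) - ?n / \<rho>"
      using \<rho> by (simp add: field_simps power2_eq_square)
    finally have "?n \<le> \<rho> * inn v (A *v v)" using \<rho> by (simp add: field_simps)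
    also have "\<dots> \<le> \<rho> * (\<rho> * inn v v)"
      using \<rho> by (intro mult_left_mono upper v) auto
    finally have "?n \<le> (\<rho> * nrm v)\<^sup>2"
      by (simp add: power_mult_distrib nrm_square) (simp add: power2_eq_square)
    then show ?thesis using \<rho> unfolding nrm_def[of "A *v v"] by (intro real_le_lsqrt) auto
  qed
  have F_pow: "?P k (axis i 1) \<in> F" for i k
    by (induction k) (simp_all add: F_axis F_inv)
  have axis_pow: "nrm (?P k (axis i 1)) \<le> \<rho> ^ k" for i k
  proof (induction k)
    case 0 show ?case by (simp add: nrm_def inn_axis ip_def trace_one)
  next
    case (Suc k)
    have "nrm (?P (Suc k) (axis i 1)) \<le> \<rho> * nrm (?P k (axis i 1))" by (simp add: bound F_pow)
    also have "\<dots> \<le> \<rho> * \<rho> ^ k" using Suc \<rho> by (intro mult_left_mono) auto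
    finally show ?case by simp
  qed
  define C where "C = (\<Sum>i\<in>UNIV. norm (v $ i))"
  have growth: "nrm (?P k v) \<le> C * \<rho> ^ k" for k
  proof -
    \<comment> \<open>\<open>v\<close> is the sum of the basis vectors multiplied from the right by
      its entries, and matrices commute with right multiplication.\<close>
    have "?P k v = (\<Sum>i\<in>UNIV. rmul (?P k (axis i 1)) (v $ i))"
    proof (induction k)
      case 0
      show ?case
        by (simp add: vec_eq_iff rmul_def axis_def if_distrib if_distribR cong del: if_weak_cong)
    next
      case (Suc k)
      then show ?case by (simp add: linear_sum[OF matrix_vector_mul_linear] matrix_mult_rmul)
    qed
    then have "nrm (?P k v) \<le> (\<Sum>i\<in>UNIV. nrm (rmul (?P k (axis i 1)) (v $ i)))"
      by (simp add: nrm_sum)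
    also have "\<dots> \<le> (\<Sum>i\<in>UNIV. norm (v $ i) * \<rho> ^ k)"
      by (intro sum_mono order_trans[OF nrm_rmul_le] mult_left_mono axis_pow) auto
    finally show ?thesis by (simp add: C_def sum_distrib_right)
  qed
  assume "\<not> ?thesis"
  then have neg: "\<rho> * inn v v < inn v (A *v v)" by simp
  then have "v \<noteq> 0" by (auto simp: inn_simps)
  then have v: "0 < inn v v" by (rule inn_self_pos)
  define r where "r = inn v (A *v v) / inn v v"
  have r: "\<rho> < r" using neg v by (simp add: r_def pos_less_divide_eq)
  \<comment> \<open>Doubling the exponent costs one Cauchy--Schwarz inequality, hence the exponents
    \<open>2 ^ k\<close>. A rate \<open>r > \<rho>\<close> contradicts
    \<open>growth\<close>.\<close>
  have r_pow: "r ^ (2 ^ k) * inn v v \<le> inn v (?P (2 ^ k) v)" for k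
  proof (induction k)
    case 0 show ?case using v by (simp add: r_def)
  next
    case (Suc k)
    let ?w = "?P (2 ^ k) v"
    have "(r ^ (2 ^ k) * inn v v)\<^sup>2 \<le> (inn v ?w)\<^sup>2"
      using Suc v r \<rho> by (intro power_mono) auto
    also have "\<dots> \<le> inn v v * inn ?w ?w" by (rule inn_Cauchy_Schwarz)
    also have "inn ?w ?w = inn v (?P (2 ^ Suc k) v)"
      using inn_funpow[OF A, of v "2 ^ k"] by simp
    finally have "inn v v * (r ^ (2 ^ Suc k) * inn v v) \<le> inn v v * inn v (?P (2 ^ Suc k) v)"
      by (simp add: power_mult_distrib power2_eq_square power_mult mult_ac)
    then show ?case using v by simp
  qed
  define M where "M = nrm v * C / inn v v"
  have le_M: "(r / \<rho>) ^ (2 ^ k) \<le> M" for k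
  proof -
    have "r ^ (2 ^ k) * inn v v \<le> nrm v * (C * \<rho> ^ (2 ^ k))"
      using r_pow[of k] inn_le_nrm[of v "?P (2 ^ k) v"]
        mult_left_mono[OF growth[of "2 ^ k"] nrm_nonneg[of v]] by linarith
    then show ?thesis using v \<rho> by (simp add: M_def power_divide field_simps)
  qed
  obtain k where "M < (r / \<rho>) ^ k"
    using real_arch_pow[of "r / \<rho>" M] r \<rho> by auto
  also have "\<dots> \<le> (r / \<rho>) ^ (2 ^ k)"
    using r \<rho> by (intro power_increasing) (auto intro: less_imp_le)
  finally show False using le_M[of k] by simp
qed

end

section \<open>Free semicircular families\<close>

fun cheb :: "nat \<Rightarrow> 'a::ring_1 \<Rightarrow> 'a" where
  "cheb 0 x = 1"
| "cheb (Suc 0) x = x"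
| "cheb (Suc (Suc n)) x = x * cheb (Suc n) x - cheb n x"

lemma continuous_on_cheb [continuous_intros]:
  fixes f :: "real \<Rightarrow> real"
  shows "continuous_on S f \<Longrightarrow> continuous_on S (\<lambda>t. cheb n (f t))"
  by (induction n rule: induct_nat_012) (auto intro!: continuous_intros)

text \<open>\<open>cheb n t\<close> is the Chebyshev polynomial of the second kind at
  \<open>t / 2\<close>; the factor \<open>sin \<theta>\<close> avoids a division.\<close>

lemma cheb_cos: "cheb n (2 * cos \<theta>) * sin \<theta> = sin (real (n + 1) * \<theta>)"
proof (induction n rule: induct_nat_012)
  case 1 show ?case using sin_double[of \<theta>] by simp
next
  case (ge2 n)
  have "sin (real (Suc (Suc n) + 1) * \<theta>) + sin (real (n + 1) * \<theta>)
      = sin (real (Suc n + 1) * \<theta> + \<theta>) + sin (real (Suc n + 1) * \<theta> - \<theta>)"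
    by (simp add: algebra_simps)
  also have "\<dots> = 2 * cos \<theta> * sin (real (Suc n + 1) * \<theta>)"
    by (simp add: sin_add sin_diff)
  finally show ?case using ge2 by (simp add: left_diff_distrib mult.assoc)
qed simp

lemma semicircle_integral:
  fixes f :: "real \<Rightarrow> real"
  assumes f: "continuous_on UNIV f"
  shows "integrable semicircle_distribution f"
    and "(LINT t|semicircle_distribution. f t)
      = integral {-2..2} (\<lambda>t. f t * sqrt (4 - t\<^sup>2)) / (2 * pi)"
proof -
  let ?w = "\<lambda>t. indicator {-2..2} t * (sqrt (4 - t\<^sup>2) / (2 * pi)) :: real"
  let ?g = "\<lambda>t. f t * sqrt (4 - t\<^sup>2) / (2 * pi)"
  have [measurable]: "f \<in> borel_measurable borel"
    by (rule borel_measurable_continuous_onI[OF f])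
  have w: "AE t in lborel. 0 \<le> ?w t"
  proof (intro AE_I2)
    fix t :: real
    have "0 \<le> 4 - t\<^sup>2" if "t \<in> {-2..2}"
      using that power_mono[of "\<bar>t\<bar>" 2 2] by (auto simp: abs_le_iff)
    then show "0 \<le> ?w t" by (auto simp: indicator_def)
  qed
  have eq: "?w t *\<^sub>R f t = indicator {-2..2} t *\<^sub>R ?g t" for t by simp
  have "continuous_on {-2..2} ?g"
    by (intro continuous_intros continuous_on_subset[OF f]) auto
  then have g: "set_integrable lborel {-2..2} ?g"
    unfolding set_integrable_def by (intro borel_integrable_compact) auto
  then have "integrable lborel (\<lambda>t. ?w t *\<^sub>R f t)"
    unfolding eq set_integrable_def .
  then show "integrable semicircle_distribution f"
    unfolding semicircle_distribution_def by (subst integrable_density) (use w in simp_all)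
  have "(LINT t|semicircle_distribution. f t) = (LINT t|lborel. ?w t *\<^sub>R f t)"
    unfolding semicircle_distribution_def by (subst integral_density) (use w in simp_all)
  also have "\<dots> = (LINT t:{-2..2}|lborel. ?g t)"
    unfolding eq set_lebesgue_integral_def ..
  also have "\<dots> = integral {-2..2} ?g" by (rule set_borel_integral_eq_integral(2)[OF g])
  finally show "(LINT t|semicircle_distribution. f t)
      = integral {-2..2} (\<lambda>t. f t * sqrt (4 - t\<^sup>2)) / (2 * pi)" by simp
qed

text \<open>The substitution \<open>t = 2 * cos \<theta>\<close> turns the integrand into the
  derivative of \<open>G\<close>, a combination of sines that vanishes at \<open>0\<close> and
  \<open>pi\<close>.\<close>

lemma semicircle_integral_cheb: "(LINT t|semicircle_distribution. cheb (Suc n) t) = 0"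
proof -
  define N where "N = Suc n"
  define G where "G \<theta> = 2 * (sin (real (N + 2) * \<theta>) / real (N + 2) - sin (real N * \<theta>) / real N)" for \<theta>
  have G: "(G has_real_derivative 2 * (cos (real (N + 2) * \<theta>) - cos (real N * \<theta>))) (at \<theta>)" for \<theta>
    unfolding G_def by (rule derivative_eq_intros refl | simp add: N_def)+
  have cos_diff': "cos (real (N + 2) * \<theta>) - cos (real N * \<theta>) = - 2 * (sin (real (N + 1) * \<theta>) * sin \<theta>)" for \<theta>
  proof -
    have "real (N + 2) * \<theta> = real (N + 1) * \<theta> + \<theta>" "real N * \<theta> = real (N + 1) * \<theta> - \<theta>"
      by (simp_all add: algebra_simps)
    then show ?thesis by (simp only: cos_add cos_diff)
  qed
  have "((\<lambda>t. cheb N t * sqrt (4 - t\<^sup>2)) has_integral G (arccos (2 / 2)) - G (arccos ((- 2) / 2))) {-2..2}"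
  \<comment> \<open>At the endpoints \<open>arccos (t / 2)\<close> is continuous but not
    differentiable.\<close>
  proof (rule fundamental_theorem_of_calculus_interior)
    show "continuous_on {-2..2} (\<lambda>t. G (arccos (t / 2)))"
      unfolding G_def by (intro continuous_intros) (auto simp: N_def)
    fix t :: real assume t: "t \<in> {-2<..<2}"
    define \<theta> where "\<theta> = arccos (t / 2)"
    have t2: "t = 2 * cos \<theta>" using t by (simp add: \<theta>_def)
    have sin: "sin \<theta> = sqrt (1 - (t / 2)\<^sup>2)" using t by (simp add: \<theta>_def sin_arccos)
    have "\<bar>t / 2\<bar> < 1" using t by auto
    then have "(t / 2)\<^sup>2 < 1" by (simp only: abs_square_less_1)
    then have sin_pos: "0 < sin \<theta>" by (simp add: sin)
    have "sqrt (4 - t\<^sup>2) = sqrt (4 * (1 - (t / 2)\<^sup>2))" by (simp add: power_divide)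
    then have sqrt: "sqrt (4 - t\<^sup>2) = 2 * sin \<theta>" by (simp only: real_sqrt_mult sin) simp
    have "((\<lambda>t. arccos (t / 2)) has_real_derivative (1 / 2) * inverse (- sqrt (1 - (t / 2)\<^sup>2))) (at t)"
      using t by (auto intro!: derivative_eq_intros)
    then have "((\<lambda>t. arccos (t / 2)) has_real_derivative (1 / 2) * inverse (- sin \<theta>)) (at t)"
      by (simp add: sin)
    from DERIV_chain2[OF G this]
    have "((\<lambda>t. G (arccos (t / 2))) has_real_derivative
        2 * (cos (real (N + 2) * \<theta>) - cos (real N * \<theta>)) * ((1 / 2) * inverse (- sin \<theta>))) (at t)"
      by (simp add: \<theta>_def)
    also have "2 * (cos (real (N + 2) * \<theta>) - cos (real N * \<theta>)) * ((1 / 2) * inverse (- sin \<theta>))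
        = 2 * sin (real (N + 1) * \<theta>)"
      unfolding cos_diff' using sin_pos by (simp add: field_simps)
    also have "\<dots> = cheb N t * sqrt (4 - t\<^sup>2)"
      unfolding sqrt cheb_cos[symmetric] by (simp add: t2)
    finally show "((\<lambda>t. G (arccos (t / 2))) has_vector_derivative cheb N t * sqrt (4 - t\<^sup>2)) (at t)"
      by (simp add: has_real_derivative_iff_has_vector_derivative)
  qed simp
  moreover have "G pi = 0" "G 0 = 0"
    unfolding G_def by (simp_all del: of_nat_add of_nat_Suc)
  ultimately have "integral {-2..2} (\<lambda>t. cheb N t * sqrt (4 - t\<^sup>2)) = 0"
    by (simp add: integral_unique)
  then show ?thesis
    by (subst semicircle_integral) (auto intro!: continuous_intros simp: N_def)
qed

text \<open>These are the words \<open>e\<^sub>w\<close>: a maximal run of \<open>n\<close> letters \<open>i\<close> contributes the factor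
  \<open>cheb n (s i)\<close>.\<close>

fun wick :: "('n \<Rightarrow> 'a::ring_1) \<Rightarrow> 'n list \<Rightarrow> 'a" where
  "wick s [] = 1"
| "wick s [i] = s i"
| "wick s (i # j # w) = s i * wick s (j # w) - (if i = j then wick s w else 0)"

lemma mult_wick:
  "s i * wick s w = wick s (i # w) + (case w of [] \<Rightarrow> 0 | j # v \<Rightarrow> if i = j then wick s v else 0)"
  by (cases w) simp_all

text \<open>Within a run the recursion of \<open>wick\<close> is the Chebyshev recursion; the
  hypothesis on \<open>w\<close> excludes a correction term at the junction.\<close>

lemma wick_replicate_append:
  assumes "w = [] \<or> hd w \<noteq> i"
  shows "wick s (replicate n i @ w) = cheb n (s i) * wick s w"
proof (induction n rule: induct_nat_012)
  case 1
  then show ?case using assms by (cases w) auto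
next
  case (ge2 n)
  have "wick s (replicate (Suc (Suc n)) i @ w)
      = s i * wick s (replicate (Suc n) i @ w) - wick s (replicate n i @ w)"
    by simp
  then show ?case by (simp only: ge2) (simp add: left_diff_distrib mult.assoc)
qed simp

text \<open>Splitting into maximal runs gives the shape that freeness asks for: neighbouring letters
  differ, and each factor has positive Chebyshev index, hence trace zero. The clause on
  \<open>hd js\<close> lets the induction prepend a run.\<close>

lemma wick_eq_prod_list:
  assumes "w \<noteq> []"
  shows "\<exists>js ys. js \<noteq> [] \<and> hd js = hd w \<and> distinct_adj js \<and>
    list_all2 (\<lambda>j y. \<exists>n. y = cheb (Suc n) (s j)) js ys \<and> wick s w = prod_list ys"
  using assms
proof (induction w rule: length_induct)
  case (1 w)
  define i where "i = hd w"
  define v where "v = dropWhile (\<lambda>j. j = i) w"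
  define m where "m = length (takeWhile (\<lambda>j. j = i) w)"
  have "takeWhile (\<lambda>j. j = i) w = replicate m i"
    unfolding m_def by (rule replicate_eqI[symmetric, THEN sym]) (auto dest: set_takeWhileD)
  then have w: "w = replicate m i @ v"
    using takeWhile_dropWhile_id[of "\<lambda>j. j = i" w] by (simp add: v_def)
  obtain n where m: "m = Suc n"
    using 1(2) by (cases w) (auto simp: m_def i_def)
  have v: "v = [] \<or> hd v \<noteq> i"
    unfolding v_def using hd_dropWhile[of "\<lambda>j. j = i" w] by blast
  have wick: "wick s w = cheb (Suc n) (s i) * wick s v"
    unfolding w m by (rule wick_replicate_append[OF v])
  show ?case
  proof (cases "v = []")
    case True
    then show ?thesis
      using wick by (intro exI[of _ "[i]"] exI[of _ "[cheb (Suc n) (s i)]"]) (auto simp: i_def)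
  next
    case False
    have "length v < length w" by (subst w) (simp add: m)
    with 1(1) False obtain js ys where js: "js \<noteq> []" "hd js = hd v" "distinct_adj js"
      "list_all2 (\<lambda>j y. \<exists>n. y = cheb (Suc n) (s j)) js ys" "wick s v = prod_list ys"
      by blast
    show ?thesis
      using wick js v False
      by (intro exI[of _ "i # js"] exI[of _ "cheb (Suc n) (s i) # ys"])
        (auto simp: i_def distinct_adj_Cons)
  qed
qed

lemma unital_star_subalgebraD:
  assumes "unital_star_subalgebra B"
  shows "1 \<in> B" and "x \<in> B \<Longrightarrow> y \<in> B \<Longrightarrow> x + y \<in> B"
    and "x \<in> B \<Longrightarrow> y \<in> B \<Longrightarrow> x * y \<in> B" and "x \<in> B \<Longrightarrow> c *\<^sub>C x \<in> B"
  using assms by (auto simp: unital_star_subalgebra_def)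

section \<open>Traces and orthogonality of words\<close>

locale semicircular_family = faithful_trace \<tau>
  for \<tau> :: "'a::cstar_algebra \<Rightarrow> complex" +
  fixes s :: "'n::finite \<Rightarrow> 'a"
  assumes semicircular: "free_semicircular_family \<tau> s"
begin

lemma star_s: "star (s i) = s i"
  using semicircular by (simp add: free_semicircular_family_def has_distribution_def)

lemma trace_power: "\<tau> (s i ^ k) = complex_of_real (LINT t|semicircle_distribution. t ^ k)"
  using semicircular by (simp add: free_semicircular_family_def has_distribution_def)

lemma trace_cheb: "\<tau> (cheb (Suc n) (s i)) = 0"
proof -
  \<comment> \<open>A power is carried along because the recursion multiplies by \<open>s i\<close>,
    and only moments of \<open>s i\<close> are given.\<close>
  have "\<tau> (s i ^ k * cheb n (s i)) = complex_of_real (LINT t|semicircle_distribution. t ^ k * cheb n t)"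
    for k n
  proof (induction n arbitrary: k rule: induct_nat_012)
    case 0 show ?case by (simp add: trace_power)
  next
    case 1 show ?case using trace_power[of i "Suc k"] by (simp add: power_Suc2 del: power_Suc)
  next
    case (ge2 n)
    have "s i ^ k * cheb (Suc (Suc n)) (s i)
        = s i ^ Suc k * cheb (Suc n) (s i) - s i ^ k * cheb n (s i)"
      by (simp add: right_diff_distrib power_Suc2 mult.assoc del: power_Suc)
    then have "\<tau> (s i ^ k * cheb (Suc (Suc n)) (s i))
        = complex_of_real ((LINT t|semicircle_distribution. t ^ Suc k * cheb (Suc n) t)
          - (LINT t|semicircle_distribution. t ^ k * cheb n t))"
      by (simp only: trace_diff ge2 of_real_diff)
    also have "(LINT t|semicircle_distribution. t ^ Suc k * cheb (Suc n) t)
          - (LINT t|semicircle_distribution. t ^ k * cheb n t)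
        = (LINT t|semicircle_distribution. t ^ Suc k * cheb (Suc n) t - t ^ k * cheb n t)"
      by (rule Bochner_Integration.integral_diff[symmetric])
        (intro semicircle_integral continuous_intros)+
    finally show ?case by (simp add: algebra_simps)
  qed
  from this[of 0 "Suc n"] show ?thesis using semicircle_integral_cheb[of n] by simp
qed

lemma trace_wick: "\<tau> (wick s w) = (if w = [] then 1 else 0)"
proof (cases "w = []")
  case False
  obtain js ys where js: "js \<noteq> []" "distinct_adj js" "wick s w = prod_list ys"
    and ys: "list_all2 (\<lambda>j y. \<exists>n. y = cheb (Suc n) (s j)) js ys"
    using wick_eq_prod_list[OF False, of s] by blast
  let ?B = "\<lambda>i. unital_star_subalgebra hull {s i}"
  have sub: "unital_star_subalgebra (?B i)" for i
    by (rule hull_in) (auto simp: unital_star_subalgebra_def)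
  have cheb: "cheb n (s i) \<in> ?B i" for n i
  proof (induction n rule: induct_nat_012)
    case 0 show ?case using unital_star_subalgebraD(1)[OF sub] by simp
  next
    case 1 show ?case by (simp add: hull_inc)
  next
    case (ge2 n)
    have "s i * cheb (Suc n) (s i) + (- 1) *\<^sub>C cheb n (s i) \<in> ?B i"
      by (intro unital_star_subalgebraD[OF sub] ge2 hull_inc) simp
    then show ?case by (simp add: scaleC_minus_left scaleC_one)
  qed
  have free: "free_subalgebras \<tau> ?B"
    using semicircular by (simp add: free_semicircular_family_def freely_independent_def)
  have "\<forall>k<length js. ys ! k \<in> ?B (js ! k) \<and> \<tau> (ys ! k) = 0"
    using ys cheb trace_cheb by (fastforce simp: list_all2_conv_all_nth)
  then have "\<tau> (prod_list ys) = 0"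
    using free js ys list_all2_lengthD[OF ys] unfolding free_subalgebras_def by metis
  then show ?thesis using False js by simp
qed (simp add: trace_one)

text \<open>The self-adjoint front letter \<open>s i\<close> of the left word moves to the right
  word, where it creates or annihilates a letter. The correction in \<open>wick\<close> is two
  letters shorter, hence the induction scheme.\<close>

lemma wick_orthonormal: "\<tau> (star (wick s v) * wick s w) = (if v = w then 1 else 0)"
proof (induction v arbitrary: w rule: induct_list012)
  case 1
  then show ?case by (simp add: trace_wick)
next
  case (2 i)
  then show ?case
    by (auto simp: star_s mult_wick trace_add trace_wick trace_zero trace_one split: list.splits)
next
  case (3 i j v)
  have "star (wick s (i # j # v)) * wick s w
      = star (wick s (j # v)) * wick s (i # w)
        + star (wick s (j # v)) * (case w of [] \<Rightarrow> 0 | k # u \<Rightarrow> if i = k then wick s u else 0)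
        - (if i = j then star (wick s v) * wick s w else 0)"
    by (simp add: star_s star_diff star_mult left_diff_distrib mult.assoc mult_wick[of s i w] distrib_left)
  then have "\<tau> (star (wick s (i # j # v)) * wick s w)
      = (if j # v = i # w then 1 else 0)
        + (case w of [] \<Rightarrow> 0 | k # u \<Rightarrow> if i = k then if j # v = u then 1 else 0 else 0)
        - (if i = j then if v = w then 1 else 0 else 0)"
    by (cases w) (simp_all add: trace_diff trace_add trace_zero 3 del: wick.simps)
  then show ?case by (cases w) auto
qed

end

section \<open>Hermitian matrices\<close>

text \<open>The complex numbers with the identity as trace: all results on forms and spectra thereby
  hold for ordinary complex matrices.\<close>

interpretation cx: faithful_trace "\<lambda>z::complex. z"
  by unfold_locales
    (auto simp: faithful_tracial_state_def scaleC_complex_def star_complex_def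
      complex_nonneg_Reals_iff mult.commute)

lemma cx_inn [simp]: "cx.inn v w = v \<bullet> w"
  by (simp add: cx.inn_def cx.ip_def inner_vec_def inner_complex_def star_complex_def)

lemma inner_mat_star:
  fixes A :: "complex^'m^'d"
  shows "(mat_star A *v v) \<bullet> w = v \<bullet> (A *v w)"
  using cx.inn_mat_star[of A v w] by simp

lemma hermitian_inner: "mat_star A = A \<Longrightarrow> (A *v v) \<bullet> w = v \<bullet> (A *v (w :: complex^'d))"
  using inner_mat_star[of A v w] by simp

lemmas matrix_vector_linear = matrix_vector_mul_linear[where 'a=complex]
lemmas matrix_vector_simps = matrix_vector_right_distrib matrix_vector_mult_diff_distrib
  matrix_vector_mult_add_rdistrib matrix_vector_mult_diff_rdistrib
  linear_neg[OF matrix_vector_linear] linear_cmul[OF matrix_vector_linear]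
  linear_sum[OF matrix_vector_linear]

lemma sum_matrix_vector_mult: "sum f I *v v = (\<Sum>i\<in>I. f i *v (v :: 'a::semiring_1^'m))"
  by (induction I rule: infinite_finite_induct) (simp_all add: matrix_vector_mult_add_rdistrib)

lemma pos_def_iff: "pos_def A \<longleftrightarrow> mat_star A = A \<and> (\<forall>v. v \<noteq> 0 \<longrightarrow> 0 < v \<bullet> (A *v v))"
  by (simp add: pos_def_def inner_vec_def inner_complex_def)

lemma pos_def_nonneg: "pos_def A \<Longrightarrow> 0 \<le> v \<bullet> (A *v v)"
  by (cases "v = 0") (auto simp: pos_def_iff less_imp_le)

lemma matrix_inv_unique:
  fixes A B :: "complex^'d^'d"
  assumes "A ** B = mat 1"
  shows "matrix_inv A = B"
proof -
  have "B ** A = mat 1" using assms by (simp add: matrix_left_right_inverse)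
  then have "invertible A" using assms by (auto simp: invertible_def)
  then have "A ** matrix_inv A = mat 1"
    unfolding invertible_def matrix_inv_def by (rule someI2_ex) blast
  then show ?thesis
    by (metis \<open>B ** A = mat 1\<close> matrix_mul_assoc matrix_mul_lid matrix_mul_rid)
qed

lemma definite_right_inverse:
  fixes A :: "complex^'d^'d"
  assumes "\<And>v. v \<noteq> 0 \<Longrightarrow> v \<bullet> (A *v v) \<noteq> 0"
  shows "A ** matrix_inv A = mat 1"
proof -
  have "\<exists>B. B ** A = mat 1"
    unfolding matrix_left_invertible_ker using assms by (metis inner_zero_right)
  then obtain B where "B ** A = mat 1" ..
  then have "A ** B = mat 1" by (simp add: matrix_left_right_inverse)
  then show ?thesis using matrix_inv_unique by metis
qed

lemma mat_star_matrix_inv: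
  fixes A :: "complex^'d^'d"
  assumes "mat_star A = A" "A ** matrix_inv A = mat 1"
  shows "mat_star (matrix_inv A) = matrix_inv A"
proof -
  have "mat_star (matrix_inv A) ** A = mat 1"
    using arg_cong[OF assms(2), of mat_star] by (simp add: mat_star_mult mat_star_mat assms(1))
  then show ?thesis using matrix_inv_unique by (metis matrix_left_right_inverse)
qed

lemma pos_def_right_inverse: "pos_def A \<Longrightarrow> A ** matrix_inv A = mat 1"
  by (rule definite_right_inverse) (metis less_irrefl pos_def_iff)

lemma mult_matrix_inv_vec: "A ** matrix_inv A = mat 1 \<Longrightarrow> A *v (matrix_inv A *v v) = (v :: complex^'d)"
  by (simp add: matrix_vector_mul_assoc)

lemma matrix_inv_minus:
  fixes A :: "complex^'d^'d"
  assumes "A ** matrix_inv A = mat 1"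
  shows "matrix_inv (- A) = - matrix_inv A"
proof (rule matrix_inv_unique)
  have "(- A) ** (- matrix_inv A) = A ** matrix_inv A"
    by (simp add: vec_eq_iff matrix_matrix_mult_def)
  then show "(- A) ** (- matrix_inv A) = mat 1" using assms by simp
qed

text \<open>Expand the nonnegative form of \<open>A\<close> at \<open>r - w\<close>, where
  \<open>A *v w = v\<close>.\<close>

lemma pos_def_Young:
  assumes "pos_def A"
  shows "2 * (v \<bullet> r) \<le> r \<bullet> (A *v r) + v \<bullet> (matrix_inv A *v v)"
proof -
  define w where "w = matrix_inv A *v v"
  have A: "mat_star A = A" using assms by (simp add: pos_def_iff)
  have w: "A *v w = v"
    unfolding w_def by (rule mult_matrix_inv_vec[OF pos_def_right_inverse[OF assms]])
  have "0 \<le> (r - w) \<bullet> (A *v (r - w))" by (rule pos_def_nonneg[OF assms])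
  also have "\<dots> = r \<bullet> (A *v r) + v \<bullet> w - 2 * (v \<bullet> r)"
    using hermitian_inner[OF A, of w r]
    by (simp add: matrix_vector_simps w inner_diff_left inner_diff_right inner_commute)
  finally show ?thesis by (simp add: w_def)
qed

text \<open>The sign \<open>\<sigma>\<close> covers positive and negative matrices at once.\<close>

lemma inverse_antitone:
  fixes A A' :: "complex^'d^'d"
  assumes A: "mat_star A = A" and pos: "\<And>v. 0 \<le> \<sigma> * (v \<bullet> (A *v v))"
    and le: "\<And>v. \<sigma> * (v \<bullet> (A *v v)) \<le> \<sigma> * (v \<bullet> (A' *v v))"
    and inv: "A ** B = mat 1" "A' ** B' = mat 1"
  shows "\<sigma> * (v \<bullet> (B' *v v)) \<le> \<sigma> * (v \<bullet> (B *v v))"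
proof -
  define r w where "r = B' *v v" and "w = B *v v"
  have r: "A' *v r = v" and w: "A *v w = v"
    by (simp_all add: r_def w_def matrix_vector_mul_assoc inv)
  have "0 \<le> \<sigma> * ((r - w) \<bullet> (A *v (r - w)))" by (rule pos)
  also have "(r - w) \<bullet> (A *v (r - w)) = r \<bullet> (A *v r) - 2 * (v \<bullet> r) + v \<bullet> w"
    using hermitian_inner[OF A, of w r]
    by (simp add: matrix_vector_simps w inner_diff_left inner_diff_right inner_commute)
  also have "\<sigma> * \<dots> = \<sigma> * (r \<bullet> (A *v r)) + \<sigma> * (v \<bullet> w - 2 * (v \<bullet> r))"
    by (simp add: algebra_simps)
  also have "\<dots> \<le> \<sigma> * (r \<bullet> (A' *v r)) + \<sigma> * (v \<bullet> w - 2 * (v \<bullet> r))"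
    using le[of r] by simp
  also have "\<dots> = \<sigma> * (v \<bullet> w) - \<sigma> * (v \<bullet> r)"
    by (simp add: r inner_commute algebra_simps)
  finally show ?thesis by (simp add: r_def w_def)
qed

lemma conj_sum_inner: "v \<bullet> (conj_sum a z *v w) = (\<Sum>k\<in>UNIV. (a k *v v) \<bullet> (z *v (a k *v w)))"
proof -
  have "v \<bullet> ((mat_star (a k) ** z ** a k) *v w) = (a k *v v) \<bullet> (z *v (a k *v w))" for k
    using inner_mat_star[of "a k" "z *v (a k *v w)" v]
    by (simp add: inner_commute flip: matrix_vector_mul_assoc)
  then show ?thesis by (simp add: conj_sum_def sum_matrix_vector_mult inner_sum_right)
qed

lemma conj_sum_mult_vec: "conj_sum a z *v w = (\<Sum>k\<in>UNIV. mat_star (a k) *v (z *v (a k *v w)))"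
  by (simp add: conj_sum_def sum_matrix_vector_mult flip: matrix_vector_mul_assoc)

lemma mat_star_conj_sum: "mat_star z = z \<Longrightarrow> mat_star (conj_sum a z) = conj_sum a z"
  by (simp add: conj_sum_def mat_star_sum mat_star_mult matrix_mul_assoc)

section \<open>The form on the free Fock space\<close>

definition words :: "nat \<Rightarrow> 'n::finite list set" where
  "words N = {w. length w \<le> N}"

lemma finite_words [simp]: "finite (words N :: 'n::finite list set)"
  using finite_lists_length_le[of "UNIV :: 'n set" N] by (simp add: words_def)

lemma Nil_in_words [simp]: "[] \<in> words N"
  by (simp add: words_def)

lemma words_Suc: "words (Suc N) = insert [] ((\<lambda>(i, w). i # w) ` (UNIV \<times> words N))"
proof -
  have "w \<in> insert [] ((\<lambda>(i, w). i # w) ` (UNIV \<times> words N))" if "w \<in> words (Suc N)" for w :: "'a list"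
    using that by (cases w) (auto simp: words_def image_iff)
  then show ?thesis by (auto simp: words_def)
qed

lemma sum_words_Suc: "(\<Sum>w\<in>words (Suc N). g w) = g [] + (\<Sum>i\<in>UNIV. \<Sum>w\<in>words N. g (i # w))"
  unfolding words_Suc
  by (subst sum.insert) (auto simp: sum.reindex inj_on_def sum.cartesian_product case_prod_unfold)

lemma sum_words_rev: "(\<Sum>w\<in>words N. g w) = (\<Sum>w\<in>words N. g (rev w))"
  by (rule sum.reindex_bij_witness[of _ rev rev]) (auto simp: words_def)

lemma sum_words_Suc_snoc: "(\<Sum>w\<in>words (Suc N). g w) = g [] + (\<Sum>i\<in>UNIV. \<Sum>w\<in>words N. g (w @ [i]))"
proof -
  have "(\<Sum>w\<in>words (Suc N). g w) = (\<Sum>w\<in>words (Suc N). g (rev w))" by (rule sum_words_rev)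
  also have "\<dots> = g [] + (\<Sum>i\<in>UNIV. \<Sum>w\<in>words N. g (rev w @ [i]))"
    by (simp add: sum_words_Suc)
  finally show ?thesis using sum_words_rev[of "\<lambda>w. g (w @ [i])" N for i] by simp
qed

definition deg_le :: "nat \<Rightarrow> ('n list \<Rightarrow> 'b::zero) \<Rightarrow> bool" where
  "deg_le N u \<longleftrightarrow> (\<forall>w. N < length w \<longrightarrow> u w = 0)"

lemma sum_words_mono:
  assumes "deg_le N g" "N \<le> M"
  shows "sum g (words M) = sum g (words N)"
  by (rule sum.mono_neutral_right[OF finite_words])
    (use assms in \<open>auto simp: words_def deg_le_def\<close>)

text \<open>The action of the sum of all \<open>c k \<otimes>\<^sub>C s k\<close> on coefficients
  with respect to words: the sum over \<open>k\<close> annihilates a first letter, the case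
  distinction creates one.\<close>

definition fock_op :: "('n::finite \<Rightarrow> complex^'m^'d) \<Rightarrow> ('n list \<Rightarrow> complex^'m) \<Rightarrow> 'n list \<Rightarrow> complex^'d"
  where "fock_op c u w =
    (\<Sum>k\<in>UNIV. c k *v u (k # w)) + (case w of [] \<Rightarrow> 0 | k # v \<Rightarrow> c k *v u v)"

lemma deg_le_fock_op: "deg_le N u \<Longrightarrow> deg_le (Suc N) (fock_op c u)"
  by (auto simp: deg_le_def fock_op_def split: list.split)

abbreviation adj :: "('n \<Rightarrow> complex^'m^'d) \<Rightarrow> 'n \<Rightarrow> complex^'d^'m" where
  "adj a \<equiv> \<lambda>k. mat_star (a k)"

text \<open>With \<open>q\<close> the vector being squared, Young's inequality is applied to
  \<open>p\<close> and \<open>q\<close> with the weight \<open>mat 1 - conj_sum a z\<close>, and to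
  \<open>V k\<close> and \<open>a k *v q\<close> with the weight \<open>z\<close>. The terms
  quadratic in \<open>q\<close> then add up to \<open>q \<bullet> q\<close>. In the application
  \<open>p\<close> is the created part and \<open>V k\<close> are the coefficients to be
  annihilated.\<close>

lemma square_le_of_positive:
  fixes a :: "'n::finite \<Rightarrow> complex^'m^'d"
  assumes z: "pos_def z" and W: "pos_def (mat 1 - conj_sum a z)"
  shows "(p + (\<Sum>k\<in>UNIV. mat_star (a k) *v V k)) \<bullet> (p + (\<Sum>k\<in>UNIV. mat_star (a k) *v V k))
    \<le> p \<bullet> (matrix_inv (mat 1 - conj_sum a z) *v p) + (\<Sum>k\<in>UNIV. V k \<bullet> (matrix_inv z *v V k))"
proof -
  define q where "q = p + (\<Sum>k\<in>UNIV. mat_star (a k) *v V k)"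
  have "2 * (q \<bullet> q) = 2 * (p \<bullet> q) + (\<Sum>k\<in>UNIV. 2 * (V k \<bullet> (a k *v q)))"
    by (subst (1) q_def) (simp add: inner_add_left inner_sum_left inner_mat_star sum_distrib_left)
  also have "\<dots> \<le> (q \<bullet> ((mat 1 - conj_sum a z) *v q) + p \<bullet> (matrix_inv (mat 1 - conj_sum a z) *v p))
      + (\<Sum>k\<in>UNIV. (a k *v q) \<bullet> (z *v (a k *v q)) + V k \<bullet> (matrix_inv z *v V k))"
    by (intro add_mono sum_mono pos_def_Young z W)
  also have "\<dots> = q \<bullet> q + (p \<bullet> (matrix_inv (mat 1 - conj_sum a z) *v p)
      + (\<Sum>k\<in>UNIV. V k \<bullet> (matrix_inv z *v V k)))"
    by (simp add: matrix_vector_simps inner_diff_right conj_sum_inner sum.distrib)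
  finally show ?thesis by (simp add: q_def)
qed

text \<open>Here Young's inequality pairs \<open>q\<close> and \<open>V k\<close> with
  \<open>r\<close> and \<open>- (a k *v r)\<close>, where \<open>r\<close> is the inverse weight
  applied to \<open>p\<close>; the terms quadratic in \<open>r\<close> add up to
  \<open>r \<bullet> p\<close>.\<close>

lemma square_ge_of_negative:
  fixes a :: "'n::finite \<Rightarrow> complex^'m^'d"
  assumes z: "pos_def (- z)" and W: "pos_def (mat 1 - conj_sum a z)"
  shows "p \<bullet> (matrix_inv (mat 1 - conj_sum a z) *v p) + (\<Sum>k\<in>UNIV. V k \<bullet> (matrix_inv z *v V k))
    \<le> (p + (\<Sum>k\<in>UNIV. mat_star (a k) *v V k)) \<bullet> (p + (\<Sum>k\<in>UNIV. mat_star (a k) *v V k))"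
proof -
  define q r where "q = p + (\<Sum>k\<in>UNIV. mat_star (a k) *v V k)"
    and "r = matrix_inv (mat 1 - conj_sum a z) *v p"
  have p: "p = (mat 1 - conj_sum a z) *v r"
    unfolding r_def by (rule mult_matrix_inv_vec[OF pos_def_right_inverse[OF W], symmetric])
  have "(- z) ** matrix_inv (- z) = mat 1" by (rule pos_def_right_inverse[OF z])
  then have inv: "matrix_inv z = - matrix_inv (- z)"
    using matrix_inv_minus[of "- z"] by simp
  have "2 * (p \<bullet> r) = 2 * (q \<bullet> r) + (\<Sum>k\<in>UNIV. 2 * (V k \<bullet> (- (a k *v r))))"
    by (simp add: q_def inner_add_left inner_sum_left inner_mat_star sum_negf sum_distrib_left)
  also have "\<dots> \<le> (q \<bullet> q + r \<bullet> r)
      + (\<Sum>k\<in>UNIV. (- (a k *v r)) \<bullet> ((- z) *v (- (a k *v r))) + V k \<bullet> (matrix_inv (- z) *v V k))"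
    by (intro add_mono sum_mono pos_def_Young z)
      (use inner_ge_zero[of "q - r"] in \<open>simp add: inner_diff_left inner_diff_right inner_commute\<close>)
  also have "\<dots> = q \<bullet> q + r \<bullet> p - (\<Sum>k\<in>UNIV. V k \<bullet> (matrix_inv z *v V k))"
    unfolding p by (simp add: inv matrix_vector_simps matrix_minus_mult_vec inner_diff_right
        conj_sum_inner sum.distrib sum_negf sum_subtractf)
  finally show ?thesis by (simp add: q_def r_def inner_commute)
qed

text \<open>The form of \<open>B - x x\<^sup>*\<close> at a Fock vector of degree at most
  \<open>N\<close>. The second sum reaches \<open>Suc N\<close> because \<open>fock_op\<close>
  raises the degree by one.\<close>

definition quad :: "('n::finite \<Rightarrow> complex^'m^'d) \<Rightarrow> complex^'d^'d \<Rightarrow> nat \<Rightarrow> ('n list \<Rightarrow> complex^'d) \<Rightarrow> real"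
  where "quad a B N u = (\<Sum>w\<in>words N. u w \<bullet> (B *v u w))
    - (\<Sum>w\<in>words (Suc N). fock_op (adj a) u w \<bullet> fock_op (adj a) u w)"

lemma lehner_matrix_inner:
  "v \<bullet> (lehner_matrix a b z *v v) = v \<bullet> (b *v v) + v \<bullet> (matrix_inv z *v v)
    + (\<Sum>i\<in>UNIV. (mat_star (a i) *v v) \<bullet> (matrix_inv (mat 1 - conj_sum a z) *v (mat_star (a i) *v v)))"
proof -
  have "v \<bullet> ((a i ** A ** mat_star (a i)) *v v) = (mat_star (a i) *v v) \<bullet> (A *v (mat_star (a i) *v v))"
    for i and A :: "complex^'c^'c"
    by (simp add: inner_mat_star flip: matrix_vector_mul_assoc)
  then show ?thesis
    by (simp add: lehner_matrix_def matrix_vector_simps sum_matrix_vector_mult inner_add_right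
        inner_sum_right)
qed

text \<open>Summed over \<open>w\<close>, the words \<open>k # w\<close> run once through all
  nonempty words, so the \<open>R\<close>-part misses exactly the empty one, while the created parts
  regroup by the word they come from.\<close>

lemma sum_fock_split:
  fixes a :: "'n::finite \<Rightarrow> complex^'m^'d" and R :: "complex^'d^'d" and W :: "complex^'m^'m"
  assumes u: "deg_le N u"
  shows "(\<Sum>w\<in>words (Suc N). (case w of [] \<Rightarrow> 0 | k # v \<Rightarrow> mat_star (a k) *v u v)
        \<bullet> (W *v (case w of [] \<Rightarrow> 0 | k # v \<Rightarrow> mat_star (a k) *v u v))
        + (\<Sum>k\<in>UNIV. u (k # w) \<bullet> (R *v u (k # w))))
    = (\<Sum>w\<in>words N. u w \<bullet> (R *v u w)
        + (\<Sum>i\<in>UNIV. (mat_star (a i) *v u w) \<bullet> (W *v (mat_star (a i) *v u w))))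
      - u [] \<bullet> (R *v u [])"
proof -
  have "(\<Sum>w\<in>words (Suc N). \<Sum>k\<in>UNIV. u (k # w) \<bullet> (R *v u (k # w)))
      = (\<Sum>w\<in>words (Suc (Suc N)). u w \<bullet> (R *v u w)) - u [] \<bullet> (R *v u [])"
    by (subst sum.swap) (simp add: sum_words_Suc[of _ "Suc N"])
  also have "(\<Sum>w\<in>words (Suc (Suc N)). u w \<bullet> (R *v u w)) = (\<Sum>w\<in>words N. u w \<bullet> (R *v u w))"
    by (rule sum_words_mono) (use u in \<open>auto simp: deg_le_def\<close>)
  finally show ?thesis
    by (subst sum.distrib) (simp add: sum_words_Suc sum.distrib sum.swap[of _ UNIV "words N"])
qed

lemma fock_form_le_of_positive:
  fixes a :: "'n::finite \<Rightarrow> complex^'m^'d"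
  assumes z: "pos_def z" and W: "pos_def (mat 1 - conj_sum a z)" and u: "deg_le N u"
  shows "(\<Sum>w\<in>words N. u w \<bullet> (b *v u w)) + (\<Sum>w\<in>words (Suc N). fock_op (adj a) u w \<bullet> fock_op (adj a) u w)
    \<le> (\<Sum>w\<in>words N. u w \<bullet> (lehner_matrix a b z *v u w))"
proof -
  have "(\<Sum>w\<in>words (Suc N). fock_op (adj a) u w \<bullet> fock_op (adj a) u w)
      \<le> (\<Sum>w\<in>words (Suc N). (case w of [] \<Rightarrow> 0 | k # v \<Rightarrow> mat_star (a k) *v u v)
        \<bullet> (matrix_inv (mat 1 - conj_sum a z) *v (case w of [] \<Rightarrow> 0 | k # v \<Rightarrow> mat_star (a k) *v u v))
        + (\<Sum>k\<in>UNIV. u (k # w) \<bullet> (matrix_inv z *v u (k # w))))"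
    unfolding fock_op_def add.commute[of "sum _ _"]
    by (intro sum_mono square_le_of_positive z W)
  \<comment> \<open>The term missing at the empty word has the favourable sign.\<close>
  moreover have "0 \<le> u [] \<bullet> (matrix_inv z *v u [])"
    using pos_def_Young[OF z, of "u []" 0] by simp
  ultimately show ?thesis
    unfolding sum_fock_split[OF u] lehner_matrix_inner by (simp add: sum.distrib)
qed

lemma fock_form_ge_of_negative:
  fixes a :: "'n::finite \<Rightarrow> complex^'m^'d"
  assumes z: "pos_def (- z)" and W: "pos_def (mat 1 - conj_sum a z)" and u: "deg_le N u"
  shows "(\<Sum>w\<in>words N. u w \<bullet> (lehner_matrix a b z *v u w))
    \<le> (\<Sum>w\<in>words N. u w \<bullet> (b *v u w)) + (\<Sum>w\<in>words (Suc N). fock_op (adj a) u w \<bullet> fock_op (adj a) u w)"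
proof -
  have "(\<Sum>w\<in>words (Suc N). (case w of [] \<Rightarrow> 0 | k # v \<Rightarrow> mat_star (a k) *v u v)
        \<bullet> (matrix_inv (mat 1 - conj_sum a z) *v (case w of [] \<Rightarrow> 0 | k # v \<Rightarrow> mat_star (a k) *v u v))
        + (\<Sum>k\<in>UNIV. u (k # w) \<bullet> (matrix_inv z *v u (k # w))))
      \<le> (\<Sum>w\<in>words (Suc N). fock_op (adj a) u w \<bullet> fock_op (adj a) u w)"
    unfolding fock_op_def add.commute[of "sum _ _"]
    by (intro sum_mono square_ge_of_negative z W)
  moreover have "u [] \<bullet> (matrix_inv z *v u []) \<le> 0"
    using pos_def_Young[OF z, of "u []" 0] matrix_inv_minus[OF pos_def_right_inverse[OF z]]
    by (simp add: matrix_minus_mult_vec)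
  ultimately show ?thesis
    unfolding sum_fock_split[OF u] lehner_matrix_inner by (simp add: sum.distrib)
qed

section \<open>The Dyson equation\<close>

lemma tendsto_matrix_mult:
  fixes X :: "_ \<Rightarrow> complex^'m^'d" and Y :: "_ \<Rightarrow> complex^'k^'m"
  assumes "(X \<longlongrightarrow> A) F" "(Y \<longlongrightarrow> B) F"
  shows "((\<lambda>n. X n ** Y n) \<longlongrightarrow> A ** B) F"
  using assms unfolding matrix_matrix_mult_def
  by (intro vec_tendstoI) (auto intro!: tendsto_intros)

lemma tendsto_matrix_vector_mult:
  fixes X :: "_ \<Rightarrow> complex^'m^'d"
  assumes "(X \<longlongrightarrow> A) F"
  shows "((\<lambda>n. X n *v c) \<longlongrightarrow> A *v c) F"
  using assms unfolding matrix_vector_mult_def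
  by (intro vec_tendstoI) (auto intro!: tendsto_intros)

lemma tendsto_mat_star:
  fixes X :: "_ \<Rightarrow> complex^'m^'d"
  assumes "(X \<longlongrightarrow> A) F"
  shows "((\<lambda>n. mat_star (X n)) \<longlongrightarrow> mat_star A) F"
  using assms unfolding mat_star_def star_complex_def
  by (intro vec_tendstoI) (auto intro!: tendsto_intros)

text \<open>Polarization recovers all entries from the quadratic form, so that monotone bounded
  forms suffice for convergence.\<close>

lemma convergent_hermitian:
  fixes X :: "nat \<Rightarrow> complex^'d^'d"
  assumes herm: "\<And>n. mat_star (X n) = X n"
    and conv: "\<And>c. convergent (\<lambda>n. c \<bullet> (X n *v c))"
  obtains L where "X \<longlonglongrightarrow> L"
proof -
  have polar: "c \<bullet> (X n *v d) = ((c + d) \<bullet> (X n *v (c + d)) - (c - d) \<bullet> (X n *v (c - d))) / 4" for c d n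
    using hermitian_inner[OF herm, of n d c]
    by (simp add: matrix_vector_simps inner_add_left inner_diff_left inner_add_right
        inner_diff_right inner_commute)
  have conv2: "convergent (\<lambda>n. c \<bullet> (X n *v d))" for c d
  proof -
    have "convergent (\<lambda>n. ((c + d) \<bullet> (X n *v (c + d)) - (c - d) \<bullet> (X n *v (c - d))) * (1 / 4))"
      by (intro convergent_mult convergent_diff conv convergent_const)
    then show ?thesis unfolding polar[of c _ d] by simp
  qed
  \<comment> \<open>For the real inner product, \<open>axis i 1\<close> and
    \<open>axis i \<i>\<close> extract the real and the imaginary part of an entry.\<close>
  define L where "L = (\<chi> i j. Complex (lim (\<lambda>n. axis i 1 \<bullet> (X n *v axis j 1)))
    (lim (\<lambda>n. axis i \<i> \<bullet> (X n *v axis j 1))))"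
  have entry: "X n $ i $ j = Complex (axis i 1 \<bullet> (X n *v axis j 1)) (axis i \<i> \<bullet> (X n *v axis j 1))"
    for n i j
    by (simp add: inner_axis' matrix_vector_mult_axis_nth inner_complex_def)
  have "(\<lambda>n. X n $ i $ j) \<longlonglongrightarrow> L $ i $ j" for i j
    unfolding entry L_def vec_lambda_beta
    by (intro tendsto_Complex convergent_LIMSEQ_iff[THEN iffD1] conv2)
  then have "X \<longlonglongrightarrow> L" by (intro vec_tendstoI)
  then show ?thesis by (rule that)
qed

text \<open>For \<open>B = t - b\<close>, the equation \<open>matrix_inv z = dyson a B z\<close>
  says exactly that \<open>lehner_matrix a b z\<close> is the scalar \<open>t\<close>.\<close>

definition dyson :: "('n::finite \<Rightarrow> complex^'m^'d) \<Rightarrow> complex^'d^'d \<Rightarrow> complex^'d^'d \<Rightarrow> complex^'d^'d" where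
  "dyson a B z = B - (\<Sum>i\<in>UNIV. a i ** matrix_inv (mat 1 - conj_sum a z) ** mat_star (a i))"

lemma dyson_inner:
  "v \<bullet> (dyson a B z *v w) = v \<bullet> (B *v w) -
    (\<Sum>i\<in>UNIV. (mat_star (a i) *v v) \<bullet> (matrix_inv (mat 1 - conj_sum a z) *v (mat_star (a i) *v w)))"
proof -
  have "v \<bullet> ((a i ** A ** mat_star (a i)) *v w) = (mat_star (a i) *v v) \<bullet> (A *v (mat_star (a i) *v w))"
    for i and A :: "complex^'c^'c"
    by (simp add: inner_mat_star flip: matrix_vector_mul_assoc)
  then show ?thesis
    by (simp add: dyson_def matrix_vector_simps sum_matrix_vector_mult inner_diff_right inner_sum_right)
qed

lemma mat_star_dyson:
  assumes "mat_star B = B" "mat_star z = z" "pos_def (mat 1 - conj_sum a z)"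
  shows "mat_star (dyson a B z) = dyson a B z"
proof -
  have "mat_star (mat 1 - conj_sum a z) = mat 1 - conj_sum a z"
    using assms(3) by (simp add: pos_def_iff)
  then have "mat_star (matrix_inv (mat 1 - conj_sum a z)) = matrix_inv (mat 1 - conj_sum a z)"
    using mat_star_matrix_inv pos_def_right_inverse[OF assms(3)] by blast
  then show ?thesis
    by (simp add: dyson_def mat_star_diff mat_star_sum mat_star_mult assms(1) matrix_mul_assoc)
qed

section \<open>Splitting the Fock space at the last letter\<close>

lemma fock_op_Nil: "fock_op c u [] = (\<Sum>k\<in>UNIV. c k *v u [k])"
  by (simp add: fock_op_def)

lemma fock_op_zero [simp]: "fock_op c (\<lambda>w. 0) = (\<lambda>w. 0)"
  by (auto simp: fock_op_def fun_eq_iff split: list.split)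

lemma fock_op_snoc:
  "fock_op c u (w @ [i]) = fock_op c (\<lambda>v. u (v @ [i])) w + (if w = [] then c i *v u [] else 0)"
  by (cases w) (simp_all add: fock_op_def)

text \<open>\<open>fock_op\<close> leaves the last letter alone except that it creates
  \<open>[i]\<close> from the empty word. Hence the form splits into one copy for each last letter
  \<open>i\<close>, corrected at the word \<open>[i]\<close>, and the terms at the empty
  word.\<close>

lemma quad_snoc:
  fixes a :: "'n::finite \<Rightarrow> complex^'m^'d" and u :: "'n list \<Rightarrow> complex^'d"
  defines "X i \<equiv> fock_op (adj a) (\<lambda>v. u (v @ [i])) []"
  shows "quad a B (Suc N) u = u [] \<bullet> (B *v u []) - fock_op (adj a) u [] \<bullet> fock_op (adj a) u []
    + (\<Sum>i\<in>UNIV. quad a B N (\<lambda>v. u (v @ [i])) + X i \<bullet> X i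
        - (X i + mat_star (a i) *v u []) \<bullet> (X i + mat_star (a i) *v u []))"
proof -
  have "(\<Sum>w\<in>words (Suc N). fock_op (adj a) u (w @ [i]) \<bullet> fock_op (adj a) u (w @ [i]))
      = (\<Sum>w\<in>words (Suc N). fock_op (adj a) (\<lambda>v. u (v @ [i])) w \<bullet> fock_op (adj a) (\<lambda>v. u (v @ [i])) w
          + (if w = [] then (X i + mat_star (a i) *v u []) \<bullet> (X i + mat_star (a i) *v u []) - X i \<bullet> X i
             else 0))" for i
    by (intro sum.cong refl) (simp add: fock_op_snoc X_def)
  then show ?thesis
    unfolding quad_def sum_words_Suc_snoc[of _ "Suc N"]
    by (simp add: sum_words_Suc_snoc[of _ N] sum.distrib sum_subtractf sum.delta)
qed

text \<open>The inverse of the splitting at the last letter, used to assemble test vectors.\<close>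

definition snoc_comb :: "'b \<Rightarrow> ('n \<Rightarrow> 'n list \<Rightarrow> 'b) \<Rightarrow> 'n list \<Rightarrow> 'b" where
  "snoc_comb c U w = (if w = [] then c else U (last w) (butlast w))"

lemma snoc_comb_simps [simp]: "snoc_comb c U [] = c" "snoc_comb c U [i] = U i []"
  "snoc_comb c U (w @ [i]) = U i w"
  by (simp_all add: snoc_comb_def)

lemma deg_le_snoc_comb: "(\<And>i. deg_le N (U i)) \<Longrightarrow> deg_le (Suc N) (snoc_comb c U)"
  by (auto simp: deg_le_def snoc_comb_def)

text \<open>A sign \<open>\<sigma>\<close> and a gap \<open>\<epsilon>\<close> such that \<open>\<sigma> (B - x x\<^sup>*) \<ge> \<epsilon>\<close> on the free Fock space. The cases
  \<open>\<sigma> = 1\<close> and \<open>\<sigma> = - 1\<close> serve the largest and the smallest spectral value.\<close>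

locale fock_gap =
  fixes a :: "'n::finite \<Rightarrow> complex^'m^'d" and B :: "complex^'d^'d" and \<sigma> \<epsilon> :: real
  assumes B: "mat_star B = B" and \<sigma>: "\<sigma> = 1 \<or> \<sigma> = - 1" and \<epsilon>: "0 < \<epsilon>"
    and gap: "\<And>N u. deg_le N u \<Longrightarrow> \<epsilon> * (\<Sum>w\<in>words N. u w \<bullet> u w) \<le> \<sigma> * quad a B N u"
begin

text \<open>The last condition, a test vector for each initial value \<open>c\<close>, makes \<open>\<sigma> dyson a B z\<close> bounded
  below by the gap.\<close>

definition good :: "complex^'d^'d \<Rightarrow> bool" where
  "good z \<longleftrightarrow> mat_star z = z \<and> (\<forall>c. 0 \<le> \<sigma> * (c \<bullet> (z *v c))) \<and> pos_def (mat 1 - conj_sum a z) \<and>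
    (\<exists>N. \<forall>c. \<exists>u. deg_le N u \<and> u [] = c \<and> quad a B N u = c \<bullet> (dyson a B z *v c))"

text \<open>The test vector has the value \<open>c\<close> at the empty word, so the gap is already
  felt there.\<close>

lemma good_dyson:
  assumes "good z"
  shows "\<epsilon> * (c \<bullet> c) \<le> \<sigma> * (c \<bullet> (dyson a B z *v c))"
proof -
  obtain N u where u: "deg_le N u" "u [] = c" "quad a B N u = c \<bullet> (dyson a B z *v c)"
    using assms unfolding good_def by blast
  have "\<epsilon> * (u [] \<bullet> u []) \<le> \<epsilon> * (\<Sum>w\<in>words N. u w \<bullet> u w)"
    using \<epsilon> by (intro mult_left_mono member_le_sum) auto
  also have "\<dots> \<le> \<sigma> * quad a B N u" by (rule gap[OF u(1)])
  finally show ?thesis by (simp add: u)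
qed

definition step :: "complex^'d^'d \<Rightarrow> complex^'d^'d" where
  "step z = matrix_inv (dyson a B z)"

lemma step_inverse: "good z \<Longrightarrow> dyson a B z ** step z = mat 1"
  unfolding step_def
proof (rule definite_right_inverse)
  fix v :: "complex^'d" assume "good z" "v \<noteq> 0"
  then have "0 < \<epsilon> * (v \<bullet> v)" "\<epsilon> * (v \<bullet> v) \<le> \<sigma> * (v \<bullet> (dyson a B z *v v))"
    using \<epsilon> good_dyson by auto
  then show "v \<bullet> (dyson a B z *v v) \<noteq> 0" by auto
qed

lemma dyson_step: "good z \<Longrightarrow> dyson a B z *v (step z *v c) = c"
  by (simp add: matrix_vector_mul_assoc step_inverse)

lemma good_mat_star_dyson: "good z \<Longrightarrow> mat_star (dyson a B z) = dyson a B z"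
  unfolding good_def using mat_star_dyson[OF B] by blast

lemma mat_star_step: "good z \<Longrightarrow> mat_star (step z) = step z"
  using mat_star_matrix_inv[OF good_mat_star_dyson] step_inverse unfolding step_def by blast

lemma step_lower:
  assumes "good z"
  shows "\<epsilon> * ((step z *v c) \<bullet> (step z *v c)) \<le> \<sigma> * (c \<bullet> (step z *v c))"
  using good_dyson[OF assms, of "step z *v c"] by (simp add: dyson_step[OF assms] inner_commute)

text \<open>The bound depends on the gap alone, which keeps the whole iteration bounded.\<close>

lemma norm_step_le:
  assumes "good z"
  shows "norm (step z *v c) \<le> norm c / \<epsilon>"
proof (cases "step z *v c = 0")
  case False
  have "\<epsilon> * (norm (step z *v c))\<^sup>2 \<le> \<bar>\<sigma> * (c \<bullet> (step z *v c))\<bar>"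
    using step_lower[OF assms, of c] by (simp add: power2_norm_eq_inner)
  also have "\<dots> \<le> norm c * norm (step z *v c)"
    using \<sigma> Cauchy_Schwarz_ineq2[of c "step z *v c"] by auto
  finally have "norm (step z *v c) * (\<epsilon> * norm (step z *v c)) \<le> norm (step z *v c) * norm c"
    by (simp add: power2_eq_square mult_ac)
  then have "\<epsilon> * norm (step z *v c) \<le> norm c" using False by simp
  then show ?thesis using \<epsilon> by (simp add: field_simps)
qed (use \<epsilon> in simp)

text \<open>Comes from evaluating the gap on test vectors that vanish at the empty word; it forces
  \<open>conj_sum a z < 1\<close>, also in the limit of the iteration.\<close>

definition contractive :: "complex^'d^'d \<Rightarrow> bool" where
  "contractive z \<longleftrightarrow> (\<forall>e. \<epsilon> * (\<Sum>k\<in>UNIV. (z *v (a k *v e)) \<bullet> (z *v (a k *v e)))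
    \<le> \<sigma> * (e \<bullet> (conj_sum a z *v e) - (conj_sum a z *v e) \<bullet> (conj_sum a z *v e)))"

text \<open>The test vector is zero at the empty word, and its part with last letter
  \<open>k\<close> is the one provided by \<open>good z\<close> for
  \<open>step z *v (a k *v e)\<close>. On that value \<open>dyson a B z\<close> returns
  \<open>a k *v e\<close>, so the parts contribute the form of \<open>conj_sum\<close>; the square
  comes from \<open>fock_op\<close> at the empty word.\<close>

lemma contractive_step:
  assumes z: "good z"
  shows "contractive (step z)"
  unfolding contractive_def
proof
  fix e
  let ?z = "step z"
  obtain N where N: "\<forall>c. \<exists>u. deg_le N u \<and> u [] = c \<and> quad a B N u = c \<bullet> (dyson a B z *v c)"
    using z unfolding good_def by blast
  obtain U where U: "\<And>k. deg_le N (U k)" "\<And>k. U k [] = ?z *v (a k *v e)"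
      "\<And>k. quad a B N (U k) = (?z *v (a k *v e)) \<bullet> (a k *v e)"
    using choice[OF allI, of "\<lambda>k u. deg_le N u \<and> u [] = ?z *v (a k *v e) \<and>
        quad a B N u = (?z *v (a k *v e)) \<bullet> (a k *v e)"]
      N[rule_format, of "?z *v (a _ *v e)"] by (auto simp: dyson_step[OF z])
  have "quad a B (Suc N) (snoc_comb 0 U)
      = e \<bullet> (conj_sum a ?z *v e) - (conj_sum a ?z *v e) \<bullet> (conj_sum a ?z *v e)"
    by (subst quad_snoc) (simp add: fock_op_Nil U conj_sum_mult_vec[symmetric] conj_sum_inner inner_commute)
  moreover have "(\<Sum>k\<in>UNIV. U k [] \<bullet> U k [])
      \<le> (\<Sum>w\<in>words (Suc N). snoc_comb 0 U w \<bullet> snoc_comb 0 U w)"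
    unfolding sum_words_Suc_snoc by (simp, intro sum_mono member_le_sum) auto
  ultimately show "\<epsilon> * (\<Sum>k\<in>UNIV. (?z *v (a k *v e)) \<bullet> (?z *v (a k *v e)))
    \<le> \<sigma> * (e \<bullet> (conj_sum a ?z *v e) - (conj_sum a ?z *v e) \<bullet> (conj_sum a ?z *v e))"
    using gap[OF deg_le_snoc_comb[of N U 0, OF U(1)]] \<epsilon> by (simp add: U) (smt (verit) mult_left_mono)
qed

text \<open>For \<open>\<sigma> = 1\<close>, adding the square of
  \<open>e - conj_sum a z *v e\<close> to the contractive inequality bounds the form from below.
  Equality would force \<open>z *v (a k *v e) = 0\<close> for all \<open>k\<close>, then
  \<open>conj_sum a z *v e = 0\<close> and \<open>e = 0\<close>. For \<open>\<sigma> = - 1\<close>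
  the matrix \<open>conj_sum a z\<close> is nonpositive.\<close>

lemma pos_def_if_contractive:
  assumes z: "mat_star z = z" and nonneg: "\<And>c. 0 \<le> \<sigma> * (c \<bullet> (z *v c))" and "contractive z"
  shows "pos_def (mat 1 - conj_sum a z)"
  unfolding pos_def_iff
proof (intro conjI allI impI)
  let ?K = "conj_sum a z"
  show "mat_star (mat 1 - ?K) = mat 1 - ?K"
    by (simp add: mat_star_diff mat_star_mat mat_star_conj_sum z)
  fix e :: "complex^'m" assume e: "e \<noteq> 0"
  have eq: "e \<bullet> ((mat 1 - ?K) *v e) = e \<bullet> e - e \<bullet> (?K *v e)"
    by (simp add: matrix_vector_simps inner_diff_right)
  consider "\<sigma> = 1" | "\<sigma> = - 1" using \<sigma> by blast
  then show "0 < e \<bullet> ((mat 1 - ?K) *v e)"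
  proof cases
    case 1
    let ?S = "\<epsilon> * (\<Sum>k\<in>UNIV. (z *v (a k *v e)) \<bullet> (z *v (a k *v e)))"
    have S: "0 \<le> ?S" using \<epsilon> by (simp add: sum_nonneg)
    have "?S \<le> e \<bullet> (?K *v e) - (?K *v e) \<bullet> (?K *v e)"
      using \<open>contractive z\<close> 1 unfolding contractive_def by simp
    then have le: "(e - ?K *v e) \<bullet> (e - ?K *v e) + ?S \<le> e \<bullet> ((mat 1 - ?K) *v e)"
      unfolding eq by (simp add: inner_diff_left inner_diff_right inner_commute)
    show ?thesis
    proof (rule ccontr)
      assume "\<not> ?thesis"
      then have "(e - ?K *v e) \<bullet> (e - ?K *v e) = 0" "?S = 0"
        using le S inner_ge_zero[of "e - ?K *v e"] by linarith+
      then have "e = ?K *v e" "\<And>k. z *v (a k *v e) = 0"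
        using \<epsilon> by (auto simp: sum_nonneg_eq_0_iff)
      then show False using e by (simp add: conj_sum_mult_vec)
    qed
  next
    case 2
    have "e \<bullet> (?K *v e) \<le> 0"
      unfolding conj_sum_inner using nonneg 2 by (intro sum_nonpos) simp
    then show ?thesis unfolding eq using e by (smt (verit) inner_gt_zero_iff)
  qed
qed

text \<open>The new test vector takes the value \<open>c\<close> at the empty word and two further
  letters: the outer one \<open>i\<close> produces the sum in \<open>dyson\<close>, the inner one
  \<open>j\<close> produces \<open>conj_sum\<close>. This is why the degree grows by two.\<close>

lemma good_step:
  assumes z: "good z"
  shows "good (step z)"
proof -
  let ?z = "step z"
  let ?K = "conj_sum a ?z"
  let ?W = "matrix_inv (mat 1 - ?K)"
  have pos: "0 \<le> \<sigma> * (c \<bullet> (?z *v c))" for c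
    using step_lower[OF z, of c] \<epsilon> by (smt (verit) inner_ge_zero mult_nonneg_nonneg)
  have K: "pos_def (mat 1 - ?K)"
    by (rule pos_def_if_contractive[OF mat_star_step[OF z] pos contractive_step[OF z]])
  have W: "?K *v (?W *v g) + g = ?W *v g" for g
    using mult_matrix_inv_vec[OF pos_def_right_inverse[OF K], of g]
    by (simp add: matrix_vector_simps algebra_simps)
  obtain N where N: "\<forall>c. \<exists>u. deg_le N u \<and> u [] = c \<and> quad a B N u = c \<bullet> (dyson a B z *v c)"
    using z unfolding good_def by blast
  then obtain V where V: "\<And>c. deg_le N (V c)" "\<And>c. V c [] = c"
      "\<And>c. quad a B N (V c) = c \<bullet> (dyson a B z *v c)"
    by metis
  have "\<exists>u. deg_le (Suc (Suc N)) u \<and> u [] = c \<and> quad a B (Suc (Suc N)) u = c \<bullet> (dyson a B ?z *v c)" for c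
  proof -
    \<comment> \<open>The stationary point of \<open>r \<bullet> (?K *v r)\<close> minus the square
      of \<open>?K *v r + mat_star (a i) *v c\<close>, the contribution of the last letter
      \<open>i\<close>; stationarity is the equation
      \<open>?K *v r + mat_star (a i) *v c = r\<close>.\<close>
    define r where "r i = ?W *v (mat_star (a i) *v c)" for i
    define T where "T i = snoc_comb 0 (\<lambda>j. V (?z *v (a j *v r i)))" for i
    have T: "quad a B (Suc N) (T i) = r i \<bullet> (?K *v r i) - (?K *v r i) \<bullet> (?K *v r i)" for i
      unfolding T_def
      by (subst quad_snoc) (simp add: fock_op_Nil V dyson_step[OF z] conj_sum_mult_vec[symmetric]
          conj_sum_inner inner_commute)
    have XT: "fock_op (adj a) (T i) [] = ?K *v r i" for i
      by (simp add: T_def fock_op_Nil V conj_sum_mult_vec)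
    have r: "?K *v r i + mat_star (a i) *v c = r i" for i unfolding r_def by (rule W)
    have r': "r i \<bullet> (?K *v r i) - r i \<bullet> r i = - ((mat_star (a i) *v c) \<bullet> r i)" for i
      using arg_cong[OF r[of i], of "inner (r i)"] by (simp add: inner_add_right inner_commute)
    have Tnil: "T i [] = 0" for i by (simp add: T_def)
    have "quad a B (Suc (Suc N)) (snoc_comb c T)
        = c \<bullet> (B *v c) + (\<Sum>i\<in>UNIV. r i \<bullet> (?K *v r i) - r i \<bullet> r i)"
      by (subst quad_snoc) (simp add: fock_op_Nil[of _ "snoc_comb c T"] Tnil T XT r)
    also have "\<dots> = c \<bullet> (B *v c) + (\<Sum>i\<in>UNIV. - ((mat_star (a i) *v c) \<bullet> r i))"
      by (simp only: r')
    also have "\<dots> = c \<bullet> (dyson a B ?z *v c)"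
      by (simp add: dyson_inner sum_negf r_def)
    finally show ?thesis
      by (intro exI[of _ "snoc_comb c T"]) (simp add: deg_le_snoc_comb T_def V)
  qed
  then show ?thesis unfolding good_def using mat_star_step[OF z] pos K by blast
qed

lemma good_zero: "good 0"
proof -
  have K: "conj_sum a 0 = 0"
    by (simp add: conj_sum_def matrix_matrix_mult_def vec_eq_iff)
  have W: "matrix_inv (mat 1 :: complex^'m^'m) = mat 1" by (rule matrix_inv_unique) simp
  \<comment> \<open>At \<open>z = 0\<close> a vector supported on the empty word suffices; taking
    degree one makes \<open>quad_snoc\<close> applicable.\<close>
  have "quad a B (Suc 0) (snoc_comb c (\<lambda>i w. 0)) = c \<bullet> (dyson a B 0 *v c)" for c
    by (subst quad_snoc) (simp add: fock_op_Nil[of _ "snoc_comb c _"] fock_op_zero dyson_inner K W quad_def sum_negf)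
  moreover have "deg_le (Suc 0) (snoc_comb c (\<lambda>i w. 0))" for c :: "complex^'d"
    by (rule deg_le_snoc_comb) (simp add: deg_le_def)
  moreover have "pos_def (mat 1 :: complex^'m^'m)" by (simp add: pos_def_iff mat_star_mat)
  ultimately show ?thesis
    unfolding good_def K
    by (auto intro!: exI[of _ "Suc 0"] exI[of _ "snoc_comb _ (\<lambda>i w. 0)"])
qed

lemma inverse_conj_sum_mono:
  assumes K: "pos_def (mat 1 - conj_sum a z)" "pos_def (mat 1 - conj_sum a z')"
    and le: "\<And>c. \<sigma> * (c \<bullet> (z *v c)) \<le> \<sigma> * (c \<bullet> (z' *v c))"
  shows "\<sigma> * (c \<bullet> (matrix_inv (mat 1 - conj_sum a z) *v c))
    \<le> \<sigma> * (c \<bullet> (matrix_inv (mat 1 - conj_sum a z') *v c))"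
proof -
  have K_le: "\<sigma> * (v \<bullet> (conj_sum a z *v v)) \<le> \<sigma> * (v \<bullet> (conj_sum a z' *v v))" for v
    unfolding conj_sum_inner sum_distrib_left by (intro sum_mono le)
  have antitone: "c \<bullet> (matrix_inv (mat 1 - conj_sum a y') *v c) \<le> c \<bullet> (matrix_inv (mat 1 - conj_sum a y) *v c)"
    if "pos_def (mat 1 - conj_sum a y)" "pos_def (mat 1 - conj_sum a y')"
      "\<And>v. v \<bullet> (conj_sum a y' *v v) \<le> v \<bullet> (conj_sum a y *v v)" for y y'
  proof -
    have "1 * (c \<bullet> (matrix_inv (mat 1 - conj_sum a y') *v c))
        \<le> 1 * (c \<bullet> (matrix_inv (mat 1 - conj_sum a y) *v c))"
    proof (rule inverse_antitone)
      show "mat_star (mat 1 - conj_sum a y) = mat 1 - conj_sum a y"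
        using that(1) by (simp add: pos_def_iff)
      show "1 * (v \<bullet> ((mat 1 - conj_sum a y) *v v)) \<le> 1 * (v \<bullet> ((mat 1 - conj_sum a y') *v v))" for v
        using that(3)[of v] by (simp add: matrix_vector_simps inner_diff_right)
    qed (use that pos_def_nonneg pos_def_right_inverse in auto)
    then show ?thesis by simp
  qed
  consider "\<sigma> = 1" | "\<sigma> = - 1" using \<sigma> by blast
  then show ?thesis
  proof cases
    case 1
    then show ?thesis using antitone[OF K(2) K(1)] K_le by simp
  next
    case 2
    then show ?thesis using antitone[OF K] K_le by simp
  qed
qed

text \<open>In the order given by \<open>\<sigma>\<close>, \<open>dyson\<close> decreases as
  \<open>z\<close> grows, and inversion reverses the order once more.\<close>

lemma step_mono:
  assumes z: "good z" "good z'"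
    and le: "\<And>c. \<sigma> * (c \<bullet> (z *v c)) \<le> \<sigma> * (c \<bullet> (z' *v c))"
  shows "\<sigma> * (c \<bullet> (step z *v c)) \<le> \<sigma> * (c \<bullet> (step z' *v c))"
proof (rule inverse_antitone[OF good_mat_star_dyson[OF z(2)] _ _ step_inverse[OF z(2)] step_inverse[OF z(1)]])
  fix v :: "complex^'d"
  show "0 \<le> \<sigma> * (v \<bullet> (dyson a B z' *v v))"
    using good_dyson[OF z(2), of v] \<epsilon> by (smt (verit) inner_ge_zero mult_nonneg_nonneg)
  have K: "pos_def (mat 1 - conj_sum a z)" "pos_def (mat 1 - conj_sum a z')"
    using z by (auto simp: good_def)
  have "(\<Sum>i\<in>UNIV. \<sigma> * ((mat_star (a i) *v v) \<bullet> (matrix_inv (mat 1 - conj_sum a z) *v (mat_star (a i) *v v))))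
    \<le> (\<Sum>i\<in>UNIV. \<sigma> * ((mat_star (a i) *v v) \<bullet> (matrix_inv (mat 1 - conj_sum a z') *v (mat_star (a i) *v v))))"
    by (intro sum_mono inverse_conj_sum_mono K le)
  then show "\<sigma> * (v \<bullet> (dyson a B z' *v v)) \<le> \<sigma> * (v \<bullet> (dyson a B z *v v))"
    by (simp add: dyson_inner right_diff_distrib sum_distrib_left)
qed

section \<open>Convergence of the iteration\<close>

definition iter :: "nat \<Rightarrow> complex^'d^'d" where
  "iter n = (step ^^ n) 0"

lemma iter_Suc: "iter (Suc n) = step (iter n)"
  by (simp add: iter_def)

lemma good_iter: "good (iter n)"
  by (induction n) (simp_all add: iter_def good_zero good_step)

lemma iter_mono: "\<sigma> * (c \<bullet> (iter n *v c)) \<le> \<sigma> * (c \<bullet> (iter (Suc n) *v c))"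
proof (induction n arbitrary: c)
  case 0
  show ?case using good_iter[of "Suc 0"] by (simp add: iter_def good_def)
next
  case (Suc n)
  show ?case using step_mono[OF good_iter good_iter Suc] by (simp only: iter_Suc)
qed

lemma convergent_if_sign_mono:
  assumes "\<And>n. \<sigma> * f n \<le> \<sigma> * f (Suc n)" "\<And>n. \<sigma> * f n \<le> M"
  shows "convergent f"
proof -
  have "incseq (\<lambda>n. \<sigma> * f n)" "\<forall>n. \<sigma> * f n \<le> M"
    using assms by (auto simp: incseq_Suc_iff)
  from incseq_convergent[OF this] obtain L where "(\<lambda>n. \<sigma> * f n) \<longlonglongrightarrow> L"
    by blast
  then have "(\<lambda>n. \<sigma> * (\<sigma> * f n)) \<longlonglongrightarrow> \<sigma> * L" by (intro tendsto_intros)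
  moreover have "\<sigma> * (\<sigma> * f n) = f n" for n using \<sigma> by auto
  ultimately show ?thesis by (auto simp: convergent_def)
qed

lemma dyson_solution:
  obtains z where "mat_star z = z" "\<And>c. c \<noteq> 0 \<Longrightarrow> 0 < \<sigma> * (c \<bullet> (z *v c))"
    "pos_def (mat 1 - conj_sum a z)" "matrix_inv z = dyson a B z"
proof -
  have "convergent (\<lambda>n. c \<bullet> (iter n *v c))" for c
  proof (rule convergent_if_sign_mono)
    fix n
    show "\<sigma> * (c \<bullet> (iter n *v c)) \<le> \<sigma> * (c \<bullet> (iter (Suc n) *v c))" by (rule iter_mono)
    have "\<sigma> * (c \<bullet> (iter n *v c)) \<le> \<sigma> * (c \<bullet> (iter (Suc n) *v c))" by (rule iter_mono)
    also have "\<dots> \<le> norm c * norm (iter (Suc n) *v c)"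
      using \<sigma> Cauchy_Schwarz_ineq2[of c "iter (Suc n) *v c"] by auto
    also have "\<dots> \<le> norm c * (norm c / \<epsilon>)"
      unfolding iter_Suc by (intro mult_left_mono norm_step_le good_iter) simp
    finally show "\<sigma> * (c \<bullet> (iter n *v c)) \<le> norm c * (norm c / \<epsilon>)" .
  qed
  then obtain z where z: "iter \<longlonglongrightarrow> z"
    using convergent_hermitian[of iter] good_iter by (metis good_def)
  have herm: "mat_star z = z"
    using LIMSEQ_unique[OF tendsto_mat_star[OF z]] z good_iter by (simp add: good_def)
  have lim: "(\<lambda>n. \<sigma> * (c \<bullet> (iter n *v c))) \<longlonglongrightarrow> \<sigma> * (c \<bullet> (z *v c))" for c
    by (intro tendsto_intros tendsto_matrix_vector_mult z)
  have iter_le: "\<sigma> * (c \<bullet> (iter n *v c)) \<le> \<sigma> * (c \<bullet> (z *v c))" for c n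
    by (rule incseq_le[OF _ lim]) (simp add: incseq_Suc_iff iter_mono)
  \<comment> \<open>Strictness comes from the first iterate \<open>step 0\<close>, which is definite
    and stays below the limit.\<close>
  have pos: "0 < \<sigma> * (c \<bullet> (z *v c))" if "c \<noteq> 0" for c
  proof -
    let ?r = "step 0 *v c"
    have "?r \<noteq> 0" using dyson_step[OF good_zero, of c] that by auto
    then have "0 < \<epsilon> * (?r \<bullet> ?r)" using \<epsilon> by simp
    also have "\<dots> \<le> \<sigma> * (c \<bullet> ?r)" by (rule step_lower[OF good_zero])
    also have "\<dots> \<le> \<sigma> * (c \<bullet> (z *v c))" using iter_le[of c "Suc 0"] by (simp add: iter_def)
    finally show ?thesis .
  qed
  have Klim: "(\<lambda>n. conj_sum a (iter n)) \<longlonglongrightarrow> conj_sum a z"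
    unfolding conj_sum_def by (intro tendsto_sum tendsto_matrix_mult tendsto_const z)
  \<comment> \<open>Being a non-strict inequality between continuous expressions,
    \<open>contractive\<close> passes to the limit and there gives back the strict
    constraint.\<close>
  have contr: "contractive z"
    unfolding contractive_def
  proof
    fix e
    show "\<epsilon> * (\<Sum>k\<in>UNIV. (z *v (a k *v e)) \<bullet> (z *v (a k *v e)))
      \<le> \<sigma> * (e \<bullet> (conj_sum a z *v e) - (conj_sum a z *v e) \<bullet> (conj_sum a z *v e))"
    proof (rule LIMSEQ_le)
      show "(\<lambda>n. \<epsilon> * (\<Sum>k\<in>UNIV. (iter n *v (a k *v e)) \<bullet> (iter n *v (a k *v e))))
        \<longlonglongrightarrow> \<epsilon> * (\<Sum>k\<in>UNIV. (z *v (a k *v e)) \<bullet> (z *v (a k *v e)))"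
        by (intro tendsto_intros tendsto_matrix_vector_mult z)
      show "(\<lambda>n. \<sigma> * (e \<bullet> (conj_sum a (iter n) *v e)
            - (conj_sum a (iter n) *v e) \<bullet> (conj_sum a (iter n) *v e)))
        \<longlonglongrightarrow> \<sigma> * (e \<bullet> (conj_sum a z *v e) - (conj_sum a z *v e) \<bullet> (conj_sum a z *v e))"
        by (intro tendsto_intros tendsto_matrix_vector_mult Klim)
      have "contractive (iter n)" if "1 \<le> n" for n
        using that contractive_step[OF good_iter] by (cases n) (auto simp: iter_Suc)
      then show "\<exists>N. \<forall>n\<ge>N. \<epsilon> * (\<Sum>k\<in>UNIV. (iter n *v (a k *v e)) \<bullet> (iter n *v (a k *v e)))
        \<le> \<sigma> * (e \<bullet> (conj_sum a (iter n) *v e)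
            - (conj_sum a (iter n) *v e) \<bullet> (conj_sum a (iter n) *v e))"
        unfolding contractive_def by blast
    qed
  qed
  have K: "pos_def (mat 1 - conj_sum a z)"
    by (rule pos_def_if_contractive[OF herm _ contr]) (metis pos inner_zero_left less_imp_le mult_zero_right order_refl)
  define W where "W n = matrix_inv (mat 1 - conj_sum a (iter n))" for n
  have Kn: "pos_def (mat 1 - conj_sum a (iter n))" for n
    using good_iter[of n] by (simp add: good_def)
  \<comment> \<open>The inverses are monotone and bounded by the inverse at \<open>z\<close>, so
    they converge; the limit is then identified from the product being \<open>mat 1\<close>.\<close>
  have "convergent (\<lambda>n. c \<bullet> (W n *v c))" for c
    unfolding W_def
    by (rule convergent_if_sign_mono)
      (rule inverse_conj_sum_mono[OF Kn Kn iter_mono], rule inverse_conj_sum_mono[OF Kn K iter_le])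
  moreover have "mat_star (W n) = W n" for n
    unfolding W_def using mat_star_matrix_inv[OF _ pos_def_right_inverse[OF Kn]] Kn by (simp add: pos_def_iff)
  ultimately obtain W' where W': "W \<longlonglongrightarrow> W'" using convergent_hermitian[of W] by metis
  have "(\<lambda>n. (mat 1 - conj_sum a (iter n)) ** W n) \<longlonglongrightarrow> (mat 1 - conj_sum a z) ** W'"
    by (intro tendsto_matrix_mult tendsto_diff tendsto_const Klim W')
  then have "(mat 1 - conj_sum a z) ** W' = mat 1"
    unfolding W_def pos_def_right_inverse[OF Kn] by (simp add: LIMSEQ_const_iff)
  then have W_eq: "matrix_inv (mat 1 - conj_sum a z) = W'" by (rule matrix_inv_unique)
  have "(\<lambda>n. dyson a B (iter n)) \<longlonglongrightarrow> dyson a B z"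
    unfolding dyson_def W_eq W_def[symmetric]
    by (intro tendsto_diff tendsto_sum tendsto_matrix_mult tendsto_const W')
  then have "(\<lambda>n. dyson a B (iter n) ** iter (Suc n)) \<longlonglongrightarrow> dyson a B z ** z"
    by (intro tendsto_matrix_mult LIMSEQ_Suc z)
  then have "dyson a B z ** z = mat 1"
    unfolding iter_Suc step_inverse[OF good_iter] by (simp add: LIMSEQ_const_iff)
  then have "matrix_inv z = dyson a B z"
    by (intro matrix_inv_unique) (simp add: matrix_left_right_inverse)
  then show ?thesis using that herm pos K by blast
qed

end

section \<open>Lehner's formula\<close>

lemma mat_tensor_nth [simp]: "(A \<otimes>\<^sub>C y) $ i $ j = (A $ i $ j) *\<^sub>C y"
  by (simp add: mat_tensor_def)

lemma mat_star_tensor: "mat_star (A \<otimes>\<^sub>C y) = mat_star A \<otimes>\<^sub>C star y"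
  by (simp add: vec_eq_iff star_scaleC star_complex_def)

lemma case_list_nth: "(case w of [] \<Rightarrow> 0 | k # v \<Rightarrow> f k v) $ i = (case w of [] \<Rightarrow> 0 | k # v \<Rightarrow> f k v $ i)"
  by (simp split: list.split)

context semicircular_family
begin

definition fvec :: "nat \<Rightarrow> ('n list \<Rightarrow> complex^'d) \<Rightarrow> 'a^'d" where
  "fvec N u = (\<chi> i. \<Sum>w\<in>words N. (u w $ i) *\<^sub>C wick s w)"

lemma fvec_nth: "fvec N u $ i = (\<Sum>w\<in>words N. (u w $ i) *\<^sub>C wick s w)"
  by (simp add: fvec_def)

lemma inn_fvec: "inn (fvec N u) (fvec N v) = (\<Sum>w\<in>words N. u w \<bullet> v w)"
proof -
  have ip: "ip (p *\<^sub>C wick s v) (q *\<^sub>C wick s w) = (if v = w then inner p q else 0)" for p q v w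
    by (simp add: ip_def star_scaleC mult_scaleC_left mult_scaleC_right trace_scaleC
        wick_orthonormal inner_complex_def)
  have "ip (fvec N u $ i) (fvec N v $ i) = (\<Sum>w\<in>words N. inner (u w $ i) (v w $ i))" for i
    by (simp add: fvec_nth ip_sum_left ip_sum_right ip)
  then have "inn (fvec N u) (fvec N v) = (\<Sum>i\<in>UNIV. \<Sum>w\<in>words N. inner (u w $ i) (v w $ i))"
    by (simp add: inn_def)
  also have "\<dots> = (\<Sum>w\<in>words N. \<Sum>i\<in>UNIV. inner (u w $ i) (v w $ i))"
    by (rule sum.swap)
  finally show ?thesis by (simp add: inner_vec_def)
qed

lemma fvec_mono: "deg_le N u \<Longrightarrow> N \<le> M \<Longrightarrow> fvec M u = fvec N u"
  unfolding vec_eq_iff fvec_nth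
  by (intro allI sum_words_mono) (auto simp: deg_le_def)

lemma fvec_diff: "fvec N (\<lambda>w. u w - v w) = fvec N u - fvec N v"
  by (simp add: vec_eq_iff fvec_nth sum_subtractf diff_conv_add_uminus scaleC_add_left
      scaleC_minus_left sum.distrib sum_negf del: add_uminus_conv_diff)

lemma fvec_add: "fvec N (\<lambda>w. u w + v w) = fvec N u + fvec N v"
  by (simp add: vec_eq_iff fvec_nth scaleC_add_left sum.distrib)

lemma fvec_scaleR: "fvec N (\<lambda>w. r *\<^sub>R u w) = r *\<^sub>R fvec N u"
proof -
  have "(r *\<^sub>R p) *\<^sub>C e = r *\<^sub>R p *\<^sub>C e" for p and e :: 'a
    unfolding scaleR_scaleC[of r "p *\<^sub>C e"] scaleC_scaleC by (simp add: scaleR_conv_of_real)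
  then show ?thesis by (simp add: vec_eq_iff fvec_nth scaleR_sum_right)
qed

lemma fvec_axis: "fvec 0 (\<lambda>w. if w = [] then axis i 1 else 0) = axis i 1"
proof -
  have "words 0 = {[] :: 'n list}" by (auto simp: words_def)
  then show ?thesis by (simp add: vec_eq_iff fvec_nth axis_def scaleC_one)
qed

lemma scalar_mult_fvec: "(A \<otimes>\<^sub>C 1) *v fvec N u = fvec N (\<lambda>w. A *v u w)"
proof -
  have "((A \<otimes>\<^sub>C 1) *v fvec N u) $ i = (\<Sum>j\<in>UNIV. \<Sum>w\<in>words N. (A $ i $ j * u w $ j) *\<^sub>C wick s w)" for i
    by (simp add: matrix_vector_mult_def fvec_nth mult_scaleC_left scaleC_sum_right scaleC_scaleC)
  also have "\<dots> i = (\<Sum>w\<in>words N. \<Sum>j\<in>UNIV. (A $ i $ j * u w $ j) *\<^sub>C wick s w)" for i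
    by (rule sum.swap)
  finally show ?thesis
    by (simp add: vec_eq_iff fvec_nth matrix_vector_mult_def scaleC_sum_left)
qed

lemma mult_fvec:
  assumes u: "deg_le N u"
  shows "(\<Sum>k\<in>UNIV. c k \<otimes>\<^sub>C s k) *v fvec N u = fvec (Suc N) (fock_op c u)"
proof -
  have "((\<Sum>k\<in>UNIV. c k \<otimes>\<^sub>C s k) *v fvec N u) $ i = fvec (Suc N) (fock_op c u) $ i" for i
  proof -
    define g where "g k w = (c k *v u w) $ i" for k w
    define ann where "ann k w = (case w of [] \<Rightarrow> 0 | j # v \<Rightarrow> if k = j then wick s v else 0)"
      for k and w :: "'n list"
    have "((c k \<otimes>\<^sub>C s k) *v fvec N u) $ i = (\<Sum>w\<in>words N. g k w *\<^sub>C (s k * wick s w))" for k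
    proof -
      have "((c k \<otimes>\<^sub>C s k) *v fvec N u) $ i
          = (\<Sum>j\<in>UNIV. \<Sum>w\<in>words N. (c k $ i $ j * u w $ j) *\<^sub>C (s k * wick s w))"
        by (simp add: matrix_vector_mult_def fvec_nth mult_scaleC_left mult_scaleC_right
            sum_distrib_left scaleC_sum_right scaleC_scaleC mult.commute)
      also have "\<dots> = (\<Sum>w\<in>words N. \<Sum>j\<in>UNIV. (c k $ i $ j * u w $ j) *\<^sub>C (s k * wick s w))"
        by (rule sum.swap)
      finally show ?thesis by (simp add: g_def matrix_vector_mult_def scaleC_sum_left)
    qed
    then have "((\<Sum>k\<in>UNIV. c k \<otimes>\<^sub>C s k) *v fvec N u) $ i
        = (\<Sum>k\<in>UNIV. \<Sum>w\<in>words N. g k w *\<^sub>C wick s (k # w))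
          + (\<Sum>k\<in>UNIV. \<Sum>w\<in>words N. g k w *\<^sub>C ann k w)"
      by (simp add: sum_matrix_vector_mult mult_wick ann_def scaleC_add_right sum.distrib)
    \<comment> \<open>Enlarging the range adds only zero terms; once the first letter is removed,
      \<open>words (Suc N)\<close> remains, as in the creation part.\<close>
    also have "(\<Sum>k\<in>UNIV. \<Sum>w\<in>words N. g k w *\<^sub>C ann k w)
        = (\<Sum>k\<in>UNIV. \<Sum>w\<in>words (Suc (Suc N)). g k w *\<^sub>C ann k w)"
      by (intro sum.cong refl sum_words_mono[symmetric]) (use u in \<open>auto simp: deg_le_def g_def\<close>)
    also have "\<dots> = (\<Sum>k\<in>UNIV. \<Sum>w\<in>words (Suc N). g k (k # w) *\<^sub>C wick s w)"
    proof (rule sum.cong[OF refl])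
      fix k
      have "(\<Sum>w\<in>words (Suc (Suc N)). g k w *\<^sub>C ann k w)
          = (\<Sum>j\<in>UNIV. \<Sum>w\<in>words (Suc N). g k (j # w) *\<^sub>C (if k = j then wick s w else 0))"
        by (simp add: sum_words_Suc[of _ "Suc N"] ann_def)
      also have "\<dots> = (\<Sum>j\<in>UNIV. if k = j then \<Sum>w\<in>words (Suc N). g k (j # w) *\<^sub>C wick s w else 0)"
        by (intro sum.cong refl) simp
      finally show "(\<Sum>w\<in>words (Suc (Suc N)). g k w *\<^sub>C ann k w)
          = (\<Sum>w\<in>words (Suc N). g k (k # w) *\<^sub>C wick s w)" by simp
    qed
    also have "\<dots> = (\<Sum>w\<in>words (Suc N). \<Sum>k\<in>UNIV. g k (k # w) *\<^sub>C wick s w)"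
      by (rule sum.swap)
    also have "(\<Sum>k\<in>UNIV. \<Sum>w\<in>words N. g k w *\<^sub>C wick s (k # w))
        = (\<Sum>w\<in>words (Suc N). (case w of [] \<Rightarrow> 0 | k # v \<Rightarrow> g k v) *\<^sub>C wick s w)"
      by (simp add: sum_words_Suc)
    finally show ?thesis
      unfolding g_def by (simp add: fvec_nth fock_op_def case_list_nth scaleC_add_left scaleC_sum_left
          sum.distrib add.commute)
  qed
  then show ?thesis by (simp add: vec_eq_iff)
qed

definition fock_vectors :: "('a^'d) set" where
  "fock_vectors = {v. \<exists>N u. deg_le N u \<and> v = fvec N u}"

lemma fock_vectors_diff:
  assumes "v \<in> fock_vectors" "w \<in> fock_vectors"
  shows "v - r *\<^sub>R w \<in> fock_vectors"
proof -
  obtain N u M t where u: "deg_le N u" "v = fvec N u" and t: "deg_le M t" "w = fvec M t"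
    using assms unfolding fock_vectors_def by blast
  have "v - r *\<^sub>R w = fvec (max N M) (\<lambda>x. u x - r *\<^sub>R t x)"
    using fvec_mono[OF u(1), of "max N M"] fvec_mono[OF t(1), of "max N M"]
    by (simp add: u t fvec_diff fvec_scaleR)
  moreover have "deg_le (max N M) (\<lambda>x. u x - r *\<^sub>R t x)"
    using u t by (auto simp: deg_le_def)
  ultimately show ?thesis unfolding fock_vectors_def by blast
qed

lemma form_le_if_form_le_on_fock:
  fixes Y :: "'a^'d^'d"
  assumes Y: "mat_star Y = Y" and inv: "\<And>v. v \<in> fock_vectors \<Longrightarrow> Y *v v \<in> fock_vectors"
    and le: "\<And>v. v \<in> fock_vectors \<Longrightarrow> inn v (Y *v v) \<le> t * inn v v"
  shows "inn v (Y *v v) \<le> t * inn v v"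
proof -
  obtain K where K: "0 < K" "\<And>v. \<bar>inn v (Y *v v)\<bar> \<le> K * inn v v" using form_bounded[of Y] by metis
  \<comment> \<open>The shift by \<open>K\<close> makes the form nonnegative, and
    \<open>\<bar>t\<bar>\<close> together with \<open>0 < K\<close> makes the shifted bound
    \<open>\<kappa> + t\<close> positive, as the cyclic criterion requires.\<close>
  define \<kappa> where "\<kappa> = K + \<bar>t\<bar>"
  define A where "A = mat (\<kappa> *\<^sub>R 1) + Y"
  have A: "A *v v = \<kappa> *\<^sub>R v + Y *v v" for v
    by (simp add: A_def matrix_vector_mult_add_rdistrib mat_scaleR_mult_vec)
  have form: "inn v (A *v v) = \<kappa> * inn v v + inn v (Y *v v)" for v
    by (simp add: A inn_simps)
  have "inn v (A *v v) \<le> (\<kappa> + t) * inn v v"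
  proof (rule form_le_if_form_le_on_cyclic[where F = fock_vectors])
    show "mat_star A = A" by (simp add: A_def mat_star_add mat_star_mat star_scaleR Y)
    show "0 < \<kappa> + t" using K(1) by (simp add: \<kappa>_def)
    show "A *v v \<in> fock_vectors" if v: "v \<in> fock_vectors" for v
      using fock_vectors_diff[OF inv[OF v] v, of "- \<kappa>"] by (simp add: A add.commute)
    show "axis i 1 \<in> fock_vectors" for i
      unfolding fock_vectors_def mem_Collect_eq
      by (intro exI[of _ 0] exI[of _ "\<lambda>w. if w = [] then axis i 1 else 0"])
        (auto simp: deg_le_def fvec_axis)
    show "0 \<le> inn v (A *v v)" for v
      using K(2)[of v] mult_right_mono[of K \<kappa> "inn v v"] unfolding form by (simp add: \<kappa>_def)
    show "inn v (A *v v) \<le> (\<kappa> + t) * inn v v" if "v \<in> fock_vectors" for v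
      using le[OF that] unfolding form by (simp add: distrib_right)
  qed (rule fock_vectors_diff)
  then show ?thesis unfolding form by (simp add: distrib_right)
qed

section \<open>Spectral edges of \<open>y\<close> and the two bounds\<close>

context
  fixes a :: "'n \<Rightarrow> complex^'m^'d" and b :: "complex^'d^'d" and y :: "'a^'d^'d"
  assumes b: "mat_star b = b"
    and y_def: "y = (\<Sum>i\<in>UNIV. a i \<otimes>\<^sub>C s i) ** mat_star (\<Sum>i\<in>UNIV. a i \<otimes>\<^sub>C s i) + b \<otimes>\<^sub>C 1"
begin

lemma mat_star_x: "mat_star (\<Sum>i\<in>UNIV. a i \<otimes>\<^sub>C s i) = (\<Sum>i\<in>UNIV. adj a i \<otimes>\<^sub>C s i)"
  by (simp add: mat_star_sum mat_star_tensor star_s)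

lemma mat_star_y: "mat_star y = y"
  by (simp add: y_def mat_star_add mat_star_mult mat_star_tensor b)

lemma y_mult_vec: "y *v v = (\<Sum>i\<in>UNIV. a i \<otimes>\<^sub>C s i) *v ((\<Sum>i\<in>UNIV. adj a i \<otimes>\<^sub>C s i) *v v) + (b \<otimes>\<^sub>C 1) *v v"
  by (simp add: y_def matrix_vector_mult_add_rdistrib matrix_vector_mul_assoc mat_star_x)

lemma y_form_fvec:
  assumes "deg_le N u"
  shows "inn (fvec N u) (y *v fvec N u) = (\<Sum>w\<in>words N. u w \<bullet> (b *v u w))
    + (\<Sum>w\<in>words (Suc N). fock_op (adj a) u w \<bullet> fock_op (adj a) u w)"
proof -
  let ?x = "\<Sum>i\<in>UNIV. a i \<otimes>\<^sub>C s i" and ?x' = "\<Sum>i\<in>UNIV. adj a i \<otimes>\<^sub>C s i"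
  have "inn (fvec N u) (?x *v (?x' *v fvec N u)) = inn (?x' *v fvec N u) (?x' *v fvec N u)"
    using inn_mat_star[of ?x "fvec N u" "?x' *v fvec N u"] unfolding mat_star_x by simp
  then show ?thesis
    by (simp add: y_mult_vec inn_simps mult_fvec[OF assms] scalar_mult_fvec inn_fvec)
qed

lemma y_fock_vectors: "v \<in> fock_vectors \<Longrightarrow> y *v v \<in> fock_vectors"
proof -
  assume "v \<in> fock_vectors"
  then obtain N u where u: "deg_le N u" "v = fvec N u" unfolding fock_vectors_def by blast
  let ?t = "fock_op a (fock_op (adj a) u)"
  have "(b \<otimes>\<^sub>C 1) *v v = fvec (Suc (Suc N)) (\<lambda>w. b *v u w)"
    unfolding u(2) scalar_mult_fvec
    by (rule fvec_mono[symmetric]) (use u(1) in \<open>auto simp: deg_le_def\<close>)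
  then have "y *v v = fvec (Suc (Suc N)) (\<lambda>w. ?t w + b *v u w)"
    by (simp add: y_mult_vec u(2) mult_fvec u(1) deg_le_fock_op fvec_add)
  moreover have "deg_le (Suc (Suc N)) (\<lambda>w. ?t w + b *v u w)"
    using deg_le_fock_op[OF deg_le_fock_op[OF u(1)]] u(1) by (auto simp: deg_le_def)
  ultimately show ?thesis unfolding fock_vectors_def by blast
qed

text \<open>This removes the algebra from the problem: what remains concerns finitely supported
  functions on words.\<close>

lemma lambda_max_y_le_iff:
  "lambda_max y \<le> t \<longleftrightarrow> (\<forall>N u. deg_le N u \<longrightarrow> (\<Sum>w\<in>words N. u w \<bullet> (b *v u w))
    + (\<Sum>w\<in>words (Suc N). fock_op (adj a) u w \<bullet> fock_op (adj a) u w) \<le> t * (\<Sum>w\<in>words N. u w \<bullet> u w))"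
    (is "_ \<longleftrightarrow> ?R")
proof
  assume "lambda_max y \<le> t"
  then have le: "inn (fvec N u) (y *v fvec N u) \<le> t * inn (fvec N u) (fvec N u)" for N u
    unfolding lambda_max_le_iff[OF mat_star_y] by blast
  show ?R using le unfolding inn_fvec by (simp flip: y_form_fvec)
next
  assume R: ?R
  have "inn v (y *v v) \<le> t * inn v v" if v: "v \<in> fock_vectors" for v
  proof -
    obtain N u where u: "deg_le N u" "v = fvec N u" using v unfolding fock_vectors_def by blast
    show ?thesis using R u(1) unfolding u(2) y_form_fvec[OF u(1)] inn_fvec by blast
  qed
  then show "lambda_max y \<le> t"
    unfolding lambda_max_le_iff[OF mat_star_y]
    using form_le_if_form_le_on_fock[OF mat_star_y y_fock_vectors] by blast
qed

lemma lambda_min_y_ge_iff: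
  "t \<le> lambda_min y \<longleftrightarrow> (\<forall>N u. deg_le N u \<longrightarrow> t * (\<Sum>w\<in>words N. u w \<bullet> u w)
    \<le> (\<Sum>w\<in>words N. u w \<bullet> (b *v u w)) + (\<Sum>w\<in>words (Suc N). fock_op (adj a) u w \<bullet> fock_op (adj a) u w))"
    (is "_ \<longleftrightarrow> ?R")
proof
  assume "t \<le> lambda_min y"
  then have le: "t * inn (fvec N u) (fvec N u) \<le> inn (fvec N u) (y *v fvec N u)" for N u
    unfolding lambda_min_ge_iff[OF mat_star_y] by blast
  show ?R using le unfolding inn_fvec by (simp flip: y_form_fvec)
next
  assume R: ?R
  have "t * inn v v \<le> inn v (y *v v)" if v: "v \<in> fock_vectors" for v
  proof -
    obtain N u where u: "deg_le N u" "v = fvec N u" using v unfolding fock_vectors_def by blast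
    show ?thesis using R u(1) unfolding u(2) y_form_fvec[OF u(1)] inn_fvec by blast
  qed
  then have le: "inn v ((- y) *v v) \<le> - t * inn v v" if "v \<in> fock_vectors" for v
    using that by (simp add: matrix_minus_mult_vec inn_simps)
  have "(- y) *v v \<in> fock_vectors" if "v \<in> fock_vectors" for v
    using fock_vectors_diff[OF fock_vectors_diff[OF that that, of 1] y_fock_vectors[OF that], of 1]
    by (simp add: matrix_minus_mult_vec)
  from form_le_if_form_le_on_fock[OF _ this le] have "inn v ((- y) *v v) \<le> - t * inn v v" for v
    by (simp add: mat_star_minus mat_star_y)
  then show "t \<le> lambda_min y"
    unfolding lambda_min_ge_iff[OF mat_star_y] by (simp add: matrix_minus_mult_vec inn_simps)
qed

lemma mat_star_lehner:
  assumes z: "mat_star z = z" "z ** matrix_inv z = mat 1" and W: "pos_def (mat 1 - conj_sum a z)"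
  shows "mat_star (lehner_matrix a b z) = lehner_matrix a b z"
proof -
  \<comment> \<open>With \<open>- b\<close> in place of \<open>B\<close>, self-adjointness of
    \<open>dyson\<close> can be reused.\<close>
  have "lehner_matrix a b z = matrix_inv z - dyson a (- b) z"
    by (simp add: lehner_matrix_def dyson_def)
  then show ?thesis
    using mat_star_matrix_inv[OF z] mat_star_dyson[OF _ z(1) W, of "- b"]
    by (simp add: mat_star_diff mat_star_minus b)
qed

lemma lambda_max_y_le_lehner:
  fixes z :: "complex^'d^'d"
  assumes "0 \<prec> z" "conj_sum a z \<prec> mat 1"
  shows "lambda_max y \<le> lambda_max (lehner_matrix a b z)"
proof -
  have z: "pos_def z" and W: "pos_def (mat 1 - conj_sum a z)"
    using assms by (auto simp: mat_less_def)
  have "mat_star (lehner_matrix a b z) = lehner_matrix a b z"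
    by (rule mat_star_lehner[OF _ pos_def_right_inverse[OF z] W]) (use z in \<open>simp add: pos_def_iff\<close>)
  then have le: "v \<bullet> (lehner_matrix a b z *v v) \<le> lambda_max (lehner_matrix a b z) * (v \<bullet> v)" for v
    using cx.lambda_max_le_iff by fastforce
  show ?thesis
    unfolding lambda_max_y_le_iff sum_distrib_left
    by (intro allI impI order_trans[OF fock_form_le_of_positive[OF z W]] sum_mono le)
qed

lemma lambda_min_y_ge_lehner:
  fixes z :: "complex^'d^'d"
  assumes "z \<prec> 0"
  shows "lambda_min (lehner_matrix a b z) \<le> lambda_min y"
proof -
  have z: "pos_def (- z)" "mat_star z = z" using assms by (auto simp: mat_less_def)
  then have neg: "v \<noteq> 0 \<Longrightarrow> v \<bullet> (z *v v) < 0" for v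
    by (auto simp: pos_def_iff matrix_minus_mult_vec)
  have nonpos: "v \<bullet> (z *v v) \<le> 0" for v by (cases "v = 0") (auto intro: less_imp_le neg)
  have W: "pos_def (mat 1 - conj_sum a z)"
    unfolding pos_def_iff
  proof (intro conjI allI impI)
    show "mat_star (mat 1 - conj_sum a z) = mat 1 - conj_sum a z"
      by (simp add: mat_star_diff mat_star_mat mat_star_conj_sum z)
    fix v :: "complex^'m" assume "v \<noteq> 0"
    moreover have "v \<bullet> (conj_sum a z *v v) \<le> 0"
      unfolding conj_sum_inner by (intro sum_nonpos nonpos)
    ultimately show "0 < v \<bullet> ((mat 1 - conj_sum a z) *v v)"
      by (simp add: matrix_vector_simps inner_diff_right) (smt (verit) inner_gt_zero_iff)
  qed
  have "z ** matrix_inv z = mat 1" by (rule definite_right_inverse) (use neg in force)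
  then have "mat_star (lehner_matrix a b z) = lehner_matrix a b z"
    by (rule mat_star_lehner[OF z(2) _ W])
  then have le: "lambda_min (lehner_matrix a b z) * (v \<bullet> v) \<le> v \<bullet> (lehner_matrix a b z *v v)" for v
    using cx.lambda_min_ge_iff by fastforce
  show ?thesis
    unfolding lambda_min_y_ge_iff sum_distrib_left
    by (intro allI impI order_trans[OF _ fock_form_ge_of_negative[OF z(1) W]] sum_mono le)
qed

section \<open>Solutions beyond the spectrum\<close>

lemma quad_shift:
  "quad a (mat (t *\<^sub>R 1) - b) N u = t * (\<Sum>w\<in>words N. u w \<bullet> u w) - ((\<Sum>w\<in>words N. u w \<bullet> (b *v u w))
    + (\<Sum>w\<in>words (Suc N). fock_op (adj a) u w \<bullet> fock_op (adj a) u w))"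
  by (simp add: quad_def matrix_vector_simps mat_scaleR_mult_vec inner_diff_right sum_subtractf
      sum_distrib_left)

lemma lehner_matrix_eq_mat:
  assumes "matrix_inv z = dyson a (mat (t *\<^sub>R 1) - b) z"
  shows "lehner_matrix a b z = mat (t *\<^sub>R 1)"
  by (simp add: lehner_matrix_def assms dyson_def)

text \<open>The distance from \<open>t\<close> to the spectrum serves as the gap, and the Dyson
  solution for \<open>t - b\<close> is the required \<open>z\<close>.\<close>

lemma lehner_matrix_above:
  assumes "lambda_max y < t"
  obtains z :: "complex^'d^'d" where "0 \<prec> z" "conj_sum a z \<prec> mat 1" "lehner_matrix a b z = mat (t *\<^sub>R 1)"
proof -
  interpret fock_gap a "mat (t *\<^sub>R 1) - b" 1 "t - lambda_max y"
  proof
    fix N and u :: "'n list \<Rightarrow> complex^'d" assume "deg_le N u"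
    then have "(\<Sum>w\<in>words N. u w \<bullet> (b *v u w))
        + (\<Sum>w\<in>words (Suc N). fock_op (adj a) u w \<bullet> fock_op (adj a) u w)
        \<le> lambda_max y * (\<Sum>w\<in>words N. u w \<bullet> u w)"
      using lambda_max_y_le_iff[of "lambda_max y"] by blast
    then show "(t - lambda_max y) * (\<Sum>w\<in>words N. u w \<bullet> u w) \<le> 1 * quad a (mat (t *\<^sub>R 1) - b) N u"
      by (simp add: quad_shift left_diff_distrib)
  qed (use assms in \<open>auto simp: mat_star_diff mat_star_mat star_complex_def b\<close>)
  obtain z where z: "mat_star z = z" "\<And>c. c \<noteq> 0 \<Longrightarrow> 0 < 1 * (c \<bullet> (z *v c))"
    "pos_def (mat 1 - conj_sum a z)" "matrix_inv z = dyson a (mat (t *\<^sub>R 1) - b) z"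
    by (rule dyson_solution) blast
  have "0 \<prec> z" using z by (simp add: mat_less_def pos_def_iff)
  moreover have "conj_sum a z \<prec> mat 1" using z by (simp add: mat_less_def mat_star_conj_sum mat_star_mat)
  ultimately show ?thesis using that lehner_matrix_eq_mat[OF z(4)] by blast
qed

lemma lehner_matrix_below:
  assumes "t < lambda_min y"
  obtains z :: "complex^'d^'d" where "z \<prec> 0" "lehner_matrix a b z = mat (t *\<^sub>R 1)"
proof -
  interpret fock_gap a "mat (t *\<^sub>R 1) - b" "- 1" "lambda_min y - t"
  proof
    fix N and u :: "'n list \<Rightarrow> complex^'d" assume "deg_le N u"
    then have "lambda_min y * (\<Sum>w\<in>words N. u w \<bullet> u w) \<le> (\<Sum>w\<in>words N. u w \<bullet> (b *v u w))
        + (\<Sum>w\<in>words (Suc N). fock_op (adj a) u w \<bullet> fock_op (adj a) u w)"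
      using lambda_min_y_ge_iff[of "lambda_min y"] by blast
    then show "(lambda_min y - t) * (\<Sum>w\<in>words N. u w \<bullet> u w)
        \<le> (- 1) * quad a (mat (t *\<^sub>R 1) - b) N u"
      by (simp add: quad_shift left_diff_distrib)
  qed (use assms in \<open>auto simp: mat_star_diff mat_star_mat star_complex_def b\<close>)
  obtain z where z: "mat_star z = z" "\<And>c. c \<noteq> 0 \<Longrightarrow> 0 < (- 1) * (c \<bullet> (z *v c))"
    "pos_def (mat 1 - conj_sum a z)" "matrix_inv z = dyson a (mat (t *\<^sub>R 1) - b) z"
    by (rule dyson_solution) blast
  have "z \<prec> 0"
    using z by (simp add: mat_less_def pos_def_iff mat_star_minus matrix_minus_mult_vec)
  then show ?thesis using that lehner_matrix_eq_mat[OF z(4)] by blast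
qed

end
end

lemma lambda_scalar:
  shows "lambda_max (mat (t *\<^sub>R 1) :: complex^'d^'d) = t"
    and "lambda_min (mat (t *\<^sub>R 1) :: complex^'d^'d) = t"
proof -
  let ?A = "mat (t *\<^sub>R 1) :: complex^'d^'d"
  have A: "mat_star ?A = ?A" by (simp add: mat_star_mat star_complex_def)
  have iff: "(\<forall>v :: complex^'d. r * (v \<bullet> v) \<le> q * (v \<bullet> v)) \<longleftrightarrow> r \<le> q" for r q
  proof
    assume "\<forall>v :: complex^'d. r * (v \<bullet> v) \<le> q * (v \<bullet> v)"
    from this[rule_format, of "axis undefined 1"] show "r \<le> q" by (simp add: inner_axis_axis)
  qed (simp add: mult_right_mono)
  have max: "lambda_max ?A \<le> q \<longleftrightarrow> t \<le> q" for q
    using cx.lambda_max_le_iff[OF A, of q] iff by (simp add: mat_scaleR_mult_vec)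
  show "lambda_max ?A = t" using max[of t] max[of "lambda_max ?A"] by simp
  have min: "q \<le> lambda_min ?A \<longleftrightarrow> q \<le> t" for q
    using cx.lambda_min_ge_iff[OF A, of q] iff by (simp add: mat_scaleR_mult_vec)
  show "lambda_min ?A = t" using min[of t] min[of "lambda_min ?A"] by simp
qed

theorem theorem1p2:
  fixes \<tau> :: "'a::cstar_algebra \<Rightarrow> complex"
    and s :: "'n::finite \<Rightarrow> 'a"
    and a :: "'n \<Rightarrow> complex^'m^'d"
    and b :: "complex^'d^'d"
    and x :: "'a^'m^'d"
  assumes "faithful_tracial_state \<tau>"
    and "free_semicircular_family \<tau> s"
    and "mat_star b = b"
    and "x = (\<Sum>i\<in>UNIV. a i \<otimes>\<^sub>C s i)"
  shows
    "(ereal (lambda_max (x ** mat_star x + b \<otimes>\<^sub>C 1)) =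
       (INF z\<in>{z. 0 \<prec> z \<and> conj_sum a z \<prec> mat 1}. ereal (lambda_max (lehner_matrix a b z)))) \<and>
     (ereal (lambda_min (x ** mat_star x + b \<otimes>\<^sub>C 1)) =
       (SUP z\<in>{z. z \<prec> 0}. ereal (lambda_min (lehner_matrix a b z)))) \<and>
     ((INF z\<in>{z. 0 \<prec> z \<and> conj_sum a z \<prec> mat 1 \<and> scalar_matrix (lehner_matrix a b z)}.
         ereal (lambda_max (lehner_matrix a b z))) =
       (INF z\<in>{z. 0 \<prec> z \<and> conj_sum a z \<prec> mat 1}. ereal (lambda_max (lehner_matrix a b z)))) \<and>
     ((SUP z\<in>{z. z \<prec> 0 \<and> scalar_matrix (lehner_matrix a b z)}.
         ereal (lambda_min (lehner_matrix a b z))) =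
       (SUP z\<in>{z. z \<prec> 0}. ereal (lambda_min (lehner_matrix a b z))))"
proof -
  interpret semicircular_family \<tau> s
    by unfold_locales (fact assms)+
  define y where "y = x ** mat_star x + b \<otimes>\<^sub>C 1"
  note y = y_def[unfolded assms(4)]
  let ?S = "{z. 0 \<prec> z \<and> conj_sum a z \<prec> mat 1}"
  let ?R = "{z. 0 \<prec> z \<and> conj_sum a z \<prec> mat 1 \<and> scalar_matrix (lehner_matrix a b z)}"
  let ?S' = "{z :: complex^'d^'d. z \<prec> 0}"
  let ?R' = "{z. z \<prec> 0 \<and> scalar_matrix (lehner_matrix a b z)}"
  let ?f = "\<lambda>z. ereal (lambda_max (lehner_matrix a b z))"
  let ?g = "\<lambda>z. ereal (lambda_min (lehner_matrix a b z))"
  have S: "ereal (lambda_max y) \<le> (INF z\<in>?S. ?f z)"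
    by (rule INF_greatest) (use lambda_max_y_le_lehner[OF assms(3) y] in auto)
  \<comment> \<open>Every scalar \<open>lambda_max y + e\<close> with \<open>e > 0\<close> is a
    value of the restricted problem. With \<open>S\<close> for the larger set, this pins both infima
    to \<open>lambda_max y\<close>.\<close>
  have R: "(INF z\<in>?R. ?f z) \<le> ereal (lambda_max y)"
  proof (rule ereal_le_epsilon2)
    fix e :: real assume "0 < e"
    then obtain z :: "complex^'d^'d" where z: "0 \<prec> z" "conj_sum a z \<prec> mat 1"
        "lehner_matrix a b z = mat ((lambda_max y + e) *\<^sub>R 1)"
      using lehner_matrix_above[OF assms(3) y, of "lambda_max y + e"] by auto
    then have "z \<in> ?R" by (auto simp: scalar_matrix_def)
    then have "(INF z\<in>?R. ?f z) \<le> ?f z" by (rule INF_lower)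
    then show "(INF z\<in>?R. ?f z) \<le> ereal (lambda_max y) + ereal e"
      by (simp only: z(3) lambda_scalar plus_ereal.simps)
  qed
  have SR: "(INF z\<in>?S. ?f z) \<le> (INF z\<in>?R. ?f z)" by (rule INF_superset_mono) auto
  have S': "(SUP z\<in>?S'. ?g z) \<le> ereal (lambda_min y)"
    by (rule SUP_least) (use lambda_min_y_ge_lehner[OF assms(3) y] in auto)
  have R': "ereal (lambda_min y) \<le> (SUP z\<in>?R'. ?g z)"
  proof (rule ereal_le_epsilon2)
    fix e :: real assume "0 < e"
    then obtain z :: "complex^'d^'d" where z: "z \<prec> 0" "lehner_matrix a b z = mat ((lambda_min y - e) *\<^sub>R 1)"
      using lehner_matrix_below[OF assms(3) y, of "lambda_min y - e"] by auto
    then have "z \<in> ?R'" by (auto simp: scalar_matrix_def)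
    then have "?g z \<le> (SUP z\<in>?R'. ?g z)" by (rule SUP_upper)
    then have "ereal (lambda_min y - e) \<le> (SUP z\<in>?R'. ?g z)"
      by (simp only: z(2) lambda_scalar)
    from add_right_mono[OF this, of "ereal e"]
    show "ereal (lambda_min y) \<le> (SUP z\<in>?R'. ?g z) + ereal e" by simp
  qed
  have SR': "(SUP z\<in>?R'. ?g z) \<le> (SUP z\<in>?S'. ?g z)" by (rule SUP_subset_mono) auto
  show ?thesis
    unfolding y_def[symmetric]
    using order_antisym[OF S order_trans[OF SR R]] order_antisym[OF order_trans[OF R S] SR]
      order_antisym[OF order_trans[OF R' SR'] S'] order_antisym[OF SR' order_trans[OF S' R']]
    by blast
qed

end
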